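(* Let $l\geq 3$ be an odd integer, $q\in k$ a primitive $l$-th root of unity, $i\in\{0,1,\dots,l-1\}$ (representing a class in $\mathbb{Z}/l\mathbb{Z}$), and $a_0,a_1,\dots,a_{l-1}\in k$. In $\mathfrak{u}_1$, write $E=E_1$, $F=F_1$, $K=K_1$ and $e_i=\frac1l\sum_{s=0}^{l-1}(q^iK)^s$. Then the element $\sum_{p=0}^{l-1}a_p\,e_iE^pF^p$ is idempotent if and only if $(a_0,a_1,\dots,a_{l-1})$ is a solution of the system of equations $$a_p=\sum_{\substack{0\leq m,s\leq l-1,\\ 0\leq j\leq\min\{m,s\},\\ m+s-j=p}}a_{m,s,j}\,a_ma_s,\qquad 0\leq p\leq l-1,$$ where $$a_{m,s,j}=([j]_q!)^2\begin{bmatrix}m\\ j\end{bmatrix}_q\begin{bmatrix}s\\ j\end{bmatrix}_q\begin{bmatrix}m+s+i\\ j\end{bmatrix}_q.$$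
   Context: $k$ is an algebraically closed field of characteristic $0$; $a_{11}=a_{22}=2$, $a_{12}=a_{21}=-1$. $U$ is the unital $k$-algebra generated by $E_i,F_i,K_i,K_i^{-1}$ ($i=1,2$) with relations (for $i,j\in\{1,2\}$): $K_iK_j=K_jK_i$; $K_iK_i^{-1}=K_i^{-1}K_i=1$; $K_iE_jK_i^{-1}=q^{a_{ji}}E_j$; $K_iF_jK_i^{-1}=q^{-a_{ji}}F_j$; $E_1F_1-F_1E_1=(K_1-K_1^{-1})/(q-q^{-1})$; $E_iF_j-F_jE_i=0$ for $(i,j)\neq(1,1)$; and for $i\neq j$, $E_i^2E_j-(q+q^{-1})E_iE_jE_i+E_jE_i^2=0$ and $F_i^2F_j-(q+q^{-1})F_iF_jF_i+F_jF_i^2=0$. Put $E_{1,2}=E_1E_2-q^{-1}E_2E_1$, $F_{1,2}=F_2F_1-qF_1F_2$. $\mathfrak{u}=U/I$, where $I$ is the two-sided ideal generated by $E_1^l,E_{1,2}^l,E_2^l,F_1^l,F_{1,2}^l,F_2^l,K_1^l-1,K_2^l-1$. $\mathfrak{u}_1$ is the subalgebra of $\mathfrak{u}$ generated by $E_1,F_1,K_1$; it is isomorphic to the quotient of $U_q(\mathfrak{sl}(2))$ by the ideal generated by $E^l,F^l,K^l-1$, and $\{e_iE^sF^t\mid 0\leq i,s,t\leq l-1\}$ is a basis of it. $[n]_q=(q^n-q^{-n})/(q-q^{-1})$, $[0]_q!=1$, $[j]_q!=[j]_q[j-1]_q\cdots[1]_q$, and for integers $n\geq j\geq 0$ with $j\leq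 l-1$ the Gaussian binomial is $\begin{bmatrix}n\\ j\end{bmatrix}_q=\frac{[n]_q[n-1]_q\cdots[n-j+1]_q}{[j]_q!}$ (well defined since $[j]_q!\neq 0$ for $j\leq l-1$, $l$ odd). *)

theory Defs
  imports
    "HOL-Library.Poly_Mapping"
    "HOL-Computational_Algebra.Computational_Algebra"
    "HOL-Algebra.Algebraic_Closure_Type"
    "HOL-Algebra.Generated_Rings"
    "HOL-Algebra.QuotRing"
begin

section \<open>Free associative algebras\<close>

text \<open>
  The free monoid on \<open>'g\<close>, written additively because the product of
  \<^theory>\<open>HOL-Library.Poly_Mapping\<close> convolves along \<open>+\<close>: thus
  \<open>'g fmon \<Rightarrow>\<^sub>0 'k\<close> is the monoid algebra of the free monoid, i.e. the free
  unital associative \<open>'k\<close>-algebra on \<open>'g\<close>.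
\<close>

datatype 'g fmon = Word (letters: "'g list")

instantiation fmon :: (type) monoid_add
begin

definition zero_fmon :: "'a fmon" where
  "0 = Word []"

definition plus_fmon :: "'a fmon \<Rightarrow> 'a fmon \<Rightarrow> 'a fmon" where
  "u + v = Word (letters u @ letters v)"

instance
  by standard (simp_all add: zero_fmon_def plus_fmon_def)

end

definition fa_gen :: "'g \<Rightarrow> ('g fmon \<Rightarrow>\<^sub>0 'k::comm_ring_1)" where
  "fa_gen g = Poly_Mapping.single (Word [g]) 1"

definition fa_const :: "'k \<Rightarrow> ('g fmon \<Rightarrow>\<^sub>0 'k::comm_ring_1)" where
  "fa_const c = Poly_Mapping.single 0 c"


section \<open>The algebras \<open>U\<close>, \<open>\<uu>\<close> and \<open>\<uu>\<^sub>1\<close>\<close>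

datatype node = N1 | N2

definition cartan :: "node \<Rightarrow> node \<Rightarrow> int" where
  "cartan i j = (if i = j then 2 else - 1)"

datatype gen = gE node | gF node | gK node | gKinv node

type_synonym 'k free_alg = "gen fmon \<Rightarrow>\<^sub>0 'k"

abbreviation fE :: "node \<Rightarrow> 'k::field free_alg" where "fE i \<equiv> fa_gen (gE i)"
abbreviation fF :: "node \<Rightarrow> 'k::field free_alg" where "fF i \<equiv> fa_gen (gF i)"
abbreviation fK :: "node \<Rightarrow> 'k::field free_alg" where "fK i \<equiv> fa_gen (gK i)"
abbreviation fKinv :: "node \<Rightarrow> 'k::field free_alg" where "fKinv i \<equiv> fa_gen (gKinv i)"

text \<open>A relation \<open>x = y\<close> is represented by \<open>x - y\<close>. Among the commutators
  \<open>E\<^sub>i F\<^sub>j - F\<^sub>j E\<^sub>i\<close> only the one with \<open>i = j = 1\<close> is nonzero; in particular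
  \<open>E\<^sub>2\<close> and \<open>F\<^sub>2\<close> commute.\<close>

definition U_rels :: "'k::field \<Rightarrow> 'k free_alg set" where
  "U_rels q =
     {fK i * fK j - fK j * fK i | i j. True}
   \<union> {fK i * fKinv i - 1 | i. True}
   \<union> {fKinv i * fK i - 1 | i. True}
   \<union> {fK i * fE j * fKinv i - fa_const (q powi cartan j i) * fE j | i j. True}
   \<union> {fK i * fF j * fKinv i - fa_const (q powi (- cartan j i)) * fF j | i j. True}
   \<union> {fE N1 * fF N1 - fF N1 * fE N1
        - fa_const (1 / (q - inverse q)) * (fK N1 - fKinv N1)}
   \<union> {fE i * fF j - fF j * fE i | i j. (i, j) \<noteq> (N1, N1)}
   \<union> {fE i ^ 2 * fE j - fa_const (q + inverse q) * fE i * fE j * fE i + fE j * fE i ^ 2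
        | i j. i \<noteq> j}
   \<union> {fF i ^ 2 * fF j - fa_const (q + inverse q) * fF i * fF j * fF i + fF j * fF i ^ 2
        | i j. i \<noteq> j}"

definition U_ideal :: "'k::field \<Rightarrow> 'k free_alg set" where
  "U_ideal q = genideal ring_of_type_algebra (U_rels q)"

definition U_alg :: "'k::field \<Rightarrow> 'k free_alg set ring" where
  "U_alg q = ring_of_type_algebra Quot (U_ideal q)"

definition to_U :: "'k::field \<Rightarrow> 'k free_alg \<Rightarrow> 'k free_alg set" where
  "to_U q x = U_ideal q +>\<^bsub>ring_of_type_algebra\<^esub> x"

text \<open>The elements \<open>E\<^sub>1\<^sub>,\<^sub>2\<close> and \<open>F\<^sub>1\<^sub>,\<^sub>2\<close>, lifted to the free algebra.\<close>

definition fE12 :: "'k::field \<Rightarrow> 'k free_alg" where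
  "fE12 q = fE N1 * fE N2 - fa_const (inverse q) * fE N2 * fE N1"

definition fF12 :: "'k::field \<Rightarrow> 'k free_alg" where
  "fF12 q = fF N2 * fF N1 - fa_const q * fF N1 * fF N2"

definition u_ideal :: "nat \<Rightarrow> 'k::field \<Rightarrow> 'k free_alg set set" where
  "u_ideal l q = genideal (U_alg q) (to_U q `
     {fE N1 ^ l, fE12 q ^ l, fE N2 ^ l, fF N1 ^ l, fF12 q ^ l, fF N2 ^ l,
      fK N1 ^ l - 1, fK N2 ^ l - 1})"

definition u_alg :: "nat \<Rightarrow> 'k::field \<Rightarrow> 'k free_alg set set ring" where
  "u_alg l q = U_alg q Quot u_ideal l q"

definition to_u :: "nat \<Rightarrow> 'k::field \<Rightarrow> 'k free_alg \<Rightarrow> 'k free_alg set set" where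
  "to_u l q x = u_ideal l q +>\<^bsub>U_alg q\<^esub> to_U q x"

definition uE :: "nat \<Rightarrow> 'k::field \<Rightarrow> node \<Rightarrow> 'k free_alg set set" where
  "uE l q i = to_u l q (fE i)"

definition uF :: "nat \<Rightarrow> 'k::field \<Rightarrow> node \<Rightarrow> 'k free_alg set set" where
  "uF l q i = to_u l q (fF i)"

definition uK :: "nat \<Rightarrow> 'k::field \<Rightarrow> node \<Rightarrow> 'k free_alg set set" where
  "uK l q i = to_u l q (fK i)"

text \<open>The structure map of the \<open>'k\<close>-algebra \<open>\<uu>\<close>: the scalar multiple \<open>c x\<close> is
  the product of \<open>uscal l q c\<close> and \<open>x\<close>.\<close>

definition uscal :: "nat \<Rightarrow> 'k::field \<Rightarrow> 'k \<Rightarrow> 'k free_alg set set" where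
  "uscal l q c = to_u l q (fa_const c)"

text \<open>A subalgebra is a subring containing the image of the structure map.\<close>

definition u1_alg :: "nat \<Rightarrow> 'k::field \<Rightarrow> 'k free_alg set set ring" where
  "u1_alg l q = (u_alg l q)
     \<lparr>carrier := generate_ring (u_alg l q)
        (range (uscal l q) \<union> {uE l q N1, uF l q N1, uK l q N1})\<rparr>"

definition ue :: "nat \<Rightarrow> 'k::field \<Rightarrow> nat \<Rightarrow> 'k free_alg set set" where
  "ue l q i = uscal l q (1 / of_nat l) \<otimes>\<^bsub>u1_alg l q\<^esub>
     (\<Oplus>\<^bsub>u1_alg l q\<^esub>s\<in>{0..l-1}.
        (uscal l q (q ^ i) \<otimes>\<^bsub>u1_alg l q\<^esub> uK l q N1) [^]\<^bsub>u1_alg l q\<^esub> s)"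

definition idempotent_element :: "('a, 'b) ring_scheme \<Rightarrow> 'a \<Rightarrow> bool" where
  "idempotent_element R x \<longleftrightarrow> x \<in> carrier R \<and> x \<otimes>\<^bsub>R\<^esub> x = x"


section \<open>Roots of unity and \<open>q\<close>-numbers\<close>

definition primitive_root_of_unity :: "nat \<Rightarrow> 'k::field \<Rightarrow> bool" where
  "primitive_root_of_unity l q \<longleftrightarrow> q ^ l = 1 \<and> (\<forall>m. 0 < m \<and> m < l \<longrightarrow> q ^ m \<noteq> 1)"

definition qnum :: "'k::field \<Rightarrow> nat \<Rightarrow> 'k" where
  "qnum q n = (q powi (int n) - q powi (- int n)) / (q - inverse q)"

definition qfact :: "'k::field \<Rightarrow> nat \<Rightarrow> 'k" where
  "qfact q j = (\<Prod>t\<in>{1..j}. qnum q t)"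

text \<open>Meant for \<open>j \<le> n\<close>, so that the subtraction does not truncate, and for \<open>j\<close> less
  than the odd order of \<open>q\<close>, so that the denominator is nonzero.\<close>

definition qbinom :: "'k::field \<Rightarrow> nat \<Rightarrow> nat \<Rightarrow> 'k" where
  "qbinom q n j = (\<Prod>t<j. qnum q (n - t)) / qfact q j"

definition idem_coeff :: "'k::field \<Rightarrow> nat \<Rightarrow> nat \<Rightarrow> nat \<Rightarrow> nat \<Rightarrow> 'k" where
  "idem_coeff q i m s j =
     (qfact q j)\<^sup>2 * qbinom q m j * qbinom q s j * qbinom q (m + s + i) j"

end

theory Submission
  imports Defs
begin

text \<open>
  Write \<open>P\<^sub>p = e\<^sub>i E\<^sup>p F\<^sup>p\<close> (\<open>diag p\<close> in the lemmas). Everything rests on the fact that these elements live in a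
  commutative algebra generated by one element. The idempotent \<open>e\<^sub>i\<close> projects onto the
  \<open>K\<close>-eigenvalue \<open>q\<^bsup>-i\<^esup>\<close>, and moving an \<open>E\<close> through \<open>F\<^sup>p\<close> behind a vector of known weight
  only costs a scalar, so that
  \<open>P\<^sub>p \<cdot> EF = P\<^sub>p\<^sub>+\<^sub>1 + c\<^sub>p P\<^sub>p\<close> with \<open>c\<^sub>p = [p] [p + 1 + i]\<close> (lemma \<open>diag_Suc\<close>).
  Hence \<open>P\<^sub>p = e\<^sub>i (EF - c\<^sub>0) \<cdots> (EF - c\<^sub>p\<^sub>-\<^sub>1)\<close> is a polynomial in \<open>EF\<close>, and products can be
  computed as for shifted powers: an induction on \<open>m\<close> gives
  \<open>P\<^sub>m P\<^sub>s = \<Sum>\<^sub>j a\<^sub>m\<^sub>,\<^sub>s\<^sub>,\<^sub>j P\<^bsub>m+s-j\<^esub>\<close> (lemma \<open>diag_mult\<close>). The inductive step is the recursion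
  \<open>a\<^sub>m\<^sub>+\<^sub>1\<^sub>,\<^sub>s\<^sub>,\<^sub>j\<^sub>+\<^sub>1 = a\<^sub>m\<^sub>,\<^sub>s\<^sub>,\<^sub>j\<^sub>+\<^sub>1 + (c\<^bsub>m+s-j\<^esub> - c\<^sub>m) a\<^sub>m\<^sub>,\<^sub>s\<^sub>,\<^sub>j\<close> (lemma \<open>idem_coeff_Suc\<close>), a consequence of
  the single identity \<open>[x][y] - [x-j][y-j] = [j][x+y-j]\<close>.

  Since \<open>P\<^sub>p = 0\<close> for \<open>p \<ge> l\<close>, comparing \<open>x\<^sup>2\<close> with \<open>x\<close> for \<open>x = \<Sum>\<^sub>p a\<^sub>p P\<^sub>p\<close> yields the system of
  equations as soon as \<open>P\<^sub>0, \<dots>, P\<^bsub>l-1\<^esub>\<close> are linearly independent in \<open>\<uu>\<close>. Independence is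
  proved by a representation of \<open>\<uu>\<close>. Highest weight modules are not sufficient: on the weight
  space that \<open>e\<^sub>i\<close> selects, their operators \<open>EF\<close> do not have enough distinct eigenvalues.
  The module used instead has basis vectors \<open>v\<^bsub>a,b\<^esub>\<close> (\<open>0 \<le> a, b < l\<close>) that behave like
  \<open>E\<^sup>a F\<^sup>b v\<^bsub>0,0\<^esub>\<close> for a vector \<open>v\<^bsub>0,0\<^esub>\<close> of weight \<open>-i\<close> without further relations, so that
  \<open>P\<^sub>p\<close> visibly maps \<open>v\<^bsub>0,0\<^esub>\<close> to \<open>v\<^bsub>p,p\<^esub>\<close>. Letting \<open>E\<^sub>2\<close> and \<open>F\<^sub>2\<close> act by zero, and \<open>K\<^sub>2\<close> by a
  suitable grading operator, makes it a module over all of \<open>\<uu>\<close>.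

  The quotients \<open>U\<close> and \<open>\<uu>\<close> are treated through the kernel of the map from the free algebra
  onto \<open>\<uu>\<close>: all computations are congruences modulo this kernel, and the kernel lies in every
  two-sided ideal that contains the relations, in particular in the annihilator of the module.
\<close>

section \<open>Quantum integers and the structure constants\<close>

definition qint :: "'k::field \<Rightarrow> int \<Rightarrow> 'k" where
  "qint q n = (q powi n - q powi (- n)) / (q - inverse q)"

lemma qnum_eq_qint: "qnum q n = qint q (int n)"
  by (simp add: qnum_def qint_def)

lemma qint_0 [simp]: "qint q 0 = 0"
  by (simp add: qint_def)

lemma qint_minus [simp]: "qint q (- n) = - qint q n"
  by (simp add: qint_def minus_divide_left)

lemma qint_1: "q - inverse q \<noteq> 0 \<Longrightarrow> qint q 1 = 1"
  by (simp add: qint_def power_int_minus)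

text \<open>
  With \<open>a = q\<^sup>x\<close>, \<open>b = q\<^sup>y\<close>, \<open>c = q\<^sup>j\<close> this is an identity of rational functions: the terms
  \<open>a/b\<close> and \<open>b/a\<close> of the two products on the left cancel, because \<open>x - y\<close> is the same in both.
  All identities between quantum integers below are instances.
\<close>

lemma qint_mult_diff:
  assumes "q \<noteq> 0"
  shows "qint q x * qint q y - qint q (x - j) * qint q (y - j) = qint q j * qint q (x + y - j)"
proof -
  define a b c where "a = q powi x" and "b = q powi y" and "c = q powi j"
  have nz: "a \<noteq> 0" "b \<noteq> 0" "c \<noteq> 0"
    using assms by (auto simp: a_def b_def c_def)
  have pw: "q powi (x - j) = a / c" "q powi (y - j) = b / c" "q powi (x + y - j) = a * b / c"
    "q powi (- x) = inverse a" "q powi (- y) = inverse b" "q powi (- j) = inverse c"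
    "q powi (- (x - j)) = c / a" "q powi (- (y - j)) = c / b" "q powi (- (x + y - j)) = c / (a * b)"
    using assms by (simp_all only: a_def b_def c_def power_int_add power_int_diff power_int_minus
        inverse_divide simp_thms)
  have "(a - inverse a) * (b - inverse b) - (a / c - c / a) * (b / c - c / b)
      = (c - inverse c) * (a * b / c - c / (a * b))"
    using nz by (simp add: field_simps)
  then show ?thesis
    unfolding qint_def pw a_def[symmetric] b_def[symmetric] c_def[symmetric]
    by (simp add: diff_divide_distrib[symmetric])
qed

text \<open>
  The inductive step for commuting \<open>E\<close> past a power of \<open>F\<close>: one more \<open>F\<close> contributes the
  commutator \<open>[n]\<close> and raises the weight seen by the remaining \<open>p\<close> factors by two.
\<close>

lemma qint_Suc_exchange:
  assumes "q \<noteq> 0" "q - inverse q \<noteq> 0"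
  shows "qint q n + qint q p * qint q (n + p + 1) = qint q (p + 1) * qint q (n + p)"
proof -
  have "qint q (p + 1) * qint q (- n - p) - qint q (p + 1 - 1) * qint q (- n - p - 1)
      = qint q 1 * qint q (p + 1 + (- n - p) - 1)"
    by (rule qint_mult_diff[OF assms(1)])
  moreover have "qint q (- n - p) = - qint q (n + p)"
    by (subst qint_minus[symmetric]) simp
  moreover have "qint q (- n - p - 1) = - qint q (n + p + 1)"
    by (subst qint_minus[symmetric]) simp
  ultimately show ?thesis
    by (simp add: qint_1[OF assms(2)] algebra_simps)
qed

definition qfalling :: "'k::field \<Rightarrow> nat \<Rightarrow> nat \<Rightarrow> 'k" where
  "qfalling q n j = (\<Prod>t<j. qnum q (n - t))"

lemma qfalling_Suc: "qfalling q n (Suc j) = qfalling q n j * qnum q (n - j)"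
  by (simp add: qfalling_def)

lemma qfalling_Suc_Suc: "qfalling q (Suc n) (Suc j) = qnum q (Suc n) * qfalling q n j"
  by (simp add: qfalling_def prod.lessThan_Suc_shift del: prod.lessThan_Suc)

lemma qfalling_eq_0: "n < j \<Longrightarrow> qfalling q n j = 0"
  by (auto simp: qfalling_def qnum_def intro!: bexI[of _ n])

lemma qfact_Suc: "qfact q (Suc j) = qfact q j * qnum q (Suc j)"
  by (simp add: qfact_def)

lemma idem_coeff_qfalling:
  assumes "qfact q j \<noteq> 0"
  shows "idem_coeff q i m s j
    = qfalling q m j * qfalling q s j * qfalling q (m + s + i) j / qfact q j"
  using assms by (simp add: idem_coeff_def qbinom_def qfalling_def[symmetric] power2_eq_square)

lemma idem_coeff_0: "idem_coeff q i m s 0 = 1"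
  by (simp add: idem_coeff_def qbinom_def qfact_def)

lemma idem_coeff_eq_0: "m < j \<or> s < j \<Longrightarrow> idem_coeff q i m s j = 0"
  by (auto simp: idem_coeff_def qbinom_def qfalling_def[symmetric] qfalling_eq_0)

text \<open>
  These are the scalars \<open>c\<^sub>p\<close> for which \<open>e E\<^bsup>p+1\<^esup> F\<^bsup>p+1\<^esup> = e E\<^sup>p F\<^sup>p (EF - c\<^sub>p)\<close>; the roots of the
  polynomial in \<open>EF\<close> that represents \<open>e E\<^sup>p F\<^sup>p\<close> are \<open>c\<^sub>0, \<dots>, c\<^sub>p\<^sub>-\<^sub>1\<close>.
\<close>

definition EF_root :: "'k::field \<Rightarrow> nat \<Rightarrow> nat \<Rightarrow> 'k" where
  "EF_root q i p = qint q (int p) * qint q (int p + 1 + int i)"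

text \<open>
  The structure constants of the basis \<open>\<Prod>\<^sub>t\<^sub><\<^sub>p (T - c\<^sub>t)\<close> of a polynomial ring obey this recursion,
  as multiplying the product for \<open>m\<close> by \<open>T - c\<^sub>m\<close> shows. For the given coefficients, common factors
  leave two instances of \<open>qint_mult_diff\<close>, which have the factor \<open>[2m + s + i + 1 - j]\<close> in common.
\<close>

lemma idem_coeff_Suc:
  assumes "q \<noteq> 0" and nz: "qfact q (Suc j) \<noteq> 0" and "j \<le> m"
  shows "idem_coeff q i (Suc m) s (Suc j) = idem_coeff q i m s (Suc j)
    + (EF_root q i (m + s - j) - EF_root q i m) * idem_coeff q i m s j"
proof (cases "j \<le> s")
  case False
  then show ?thesis
    by (simp add: idem_coeff_eq_0)
next
  case True
  define N where "N = m + s + i"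
  have nz': "qfact q j \<noteq> 0" "qnum q (Suc j) \<noteq> 0"
    using nz by (auto simp: qfact_Suc)
  have 1: "qint q (int m + 1) * qint q (int N + 1) - qint q (int m - int j) * qint q (int N - int j)
      = qint q (int j + 1) * qint q (int m + int N + 1 - int j)"
    using qint_mult_diff[OF assms(1), of "int m + 1" "int N + 1" "int j + 1"]
    by (simp add: algebra_simps)
  have 2: "EF_root q i (m + s - j) - EF_root q i m
      = qint q (int s - int j) * qint q (int m + int N + 1 - int j)"
    using qint_mult_diff[OF assms(1), of "int m + int s - int j" "int m + int s - int j + 1 + int i"
        "int s - int j"] True
    by (simp add: EF_root_def N_def of_nat_diff algebra_simps)
  have q: "qnum q (Suc m) = qint q (int m + 1)" "qnum q (Suc N) = qint q (int N + 1)"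
    "qnum q (m - j) = qint q (int m - int j)" "qnum q (N - j) = qint q (int N - int j)"
    "qnum q (s - j) = qint q (int s - int j)" "qnum q (Suc j) = qint q (int j + 1)"
    using True \<open>j \<le> m\<close> by (simp_all add: qnum_eq_qint N_def of_nat_diff algebra_simps)
  have "idem_coeff q i (Suc m) s (Suc j) - idem_coeff q i m s (Suc j)
      = qfalling q m j * qfalling q s j * qfalling q N j * qnum q (s - j)
        * (qnum q (Suc m) * qnum q (Suc N) - qnum q (m - j) * qnum q (N - j)) / qfact q (Suc j)"
    unfolding idem_coeff_qfalling[OF nz] add_Suc N_def[symmetric] qfalling_Suc_Suc
    unfolding qfalling_Suc diff_divide_distrib[symmetric]
    by (simp add: algebra_simps)
  also have "\<dots> = qfalling q m j * qfalling q s j * qfalling q N j * qint q (int s - int j)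
        * qint q (int m + int N + 1 - int j) / qfact q j"
    unfolding q 1 qfact_Suc using nz'(2) by (simp add: q)
  also have "\<dots> = (EF_root q i (m + s - j) - EF_root q i m) * idem_coeff q i m s j"
    unfolding 2 idem_coeff_qfalling[OF nz'(1)] N_def[symmetric] by simp
  finally show ?thesis
    by (simp add: algebra_simps)
qed

lemma primitive_root_dvd:
  assumes "primitive_root_of_unity l q" "q ^ n = 1" "l > 0"
  shows "l dvd n"
proof -
  have "q ^ n = q ^ (l * (n div l) + n mod l)"
    by simp
  also have "\<dots> = q ^ (n mod l)"
    unfolding power_add power_mult using assms(1) by (simp add: primitive_root_of_unity_def)
  finally have "n mod l = 0"
    using assms by (metis primitive_root_of_unity_def mod_less_divisor neq0_conv)
  then show ?thesis
    by auto
qed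

lemma primitive_root_nonzero:
  assumes "primitive_root_of_unity l q" "l > 0"
  shows "q \<noteq> 0"
  using assms by (auto simp: primitive_root_of_unity_def power_0_left split: if_splits)

lemma qint_eq_0_imp_dvd:
  assumes "primitive_root_of_unity l q" "odd l" "q - inverse q \<noteq> 0" "qint q (int n) = 0"
  shows "l dvd n"
proof -
  have l: "l > 0" using \<open>odd l\<close> by (rule odd_pos)
  have "q \<noteq> 0" by (rule primitive_root_nonzero[OF assms(1) l])
  have "q ^ n = inverse (q ^ n)"
    using assms(3,4) by (simp add: qint_def power_int_minus)
  then have "q ^ (2 * n) = 1"
    using \<open>q \<noteq> 0\<close> by (simp add: field_simps power_mult power2_eq_square power_mult_distrib
        flip: power_even_eq)
  then have "l dvd 2 * n"
    using primitive_root_dvd[OF assms(1) _ l] by blast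
  then show ?thesis
    using \<open>odd l\<close> by (simp add: coprime_dvd_mult_right_iff coprime_right_2_iff_odd)
qed

lemma primitive_root_qint_denominator:
  assumes "primitive_root_of_unity l q" "l \<ge> 3"
  shows "q - inverse q \<noteq> 0"
proof
  assume "q - inverse q = 0"
  moreover have "q \<noteq> 0" using assms by (intro primitive_root_nonzero) auto
  ultimately have "q ^ 2 = 1"
    by (simp add: power2_eq_square field_simps)
  then show False
    using assms by (auto simp: primitive_root_of_unity_def)
qed

text \<open>
  Since \<open>l\<close> is odd, \<open>q\<^sup>2\<close> has order \<open>l\<close> as well, so \<open>[t]\<close> vanishes only at multiples of \<open>l\<close>.
\<close>

lemma qfact_nonzero:
  assumes "primitive_root_of_unity l q" "l \<ge> 3" "odd l" "j < l"
  shows "qfact q j \<noteq> 0"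
proof -
  have "qint q (int t) \<noteq> 0" if "t \<in> {1..j}" for t
    using qint_eq_0_imp_dvd[OF assms(1,3) primitive_root_qint_denominator[OF assms(1,2)], of t]
      dvd_imp_le[of l t] that assms(4) by fastforce
  then show ?thesis
    by (auto simp: qfact_def qnum_eq_qint)
qed

lemma qint_eq_0_of_dvd:
  assumes "q ^ l = 1" "int l dvd n"
  shows "qint q n = 0"
proof -
  have "q powi n = 1"
    using assms by (auto elim!: dvdE simp: power_int_mult)
  then show ?thesis by (simp add: qint_def power_int_minus)
qed

section \<open>Congruences in an algebra satisfying the relations of \<open>U\<^sub>q(sl\<^sub>2)\<close>\<close>

text \<open>
  Computing in a quotient ring is done by congruences in the ring itself, which keeps the
  automation for type classes available.
\<close>

locale ideal_congruence =
  fixes J :: "'a::ring_1 set"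
  assumes zero_mem: "0 \<in> J"
    and diff_mem: "x \<in> J \<Longrightarrow> y \<in> J \<Longrightarrow> x - y \<in> J"
    and lmult_mem: "x \<in> J \<Longrightarrow> z * x \<in> J"
    and rmult_mem: "x \<in> J \<Longrightarrow> x * z \<in> J"
begin

definition cong_mod (infix "\<approx>" 50) where
  "x \<approx> y \<longleftrightarrow> x - y \<in> J"

lemma uminus_mem: "x \<in> J \<Longrightarrow> - x \<in> J"
  using diff_mem[OF zero_mem, of x] by simp

lemma add_mem: "x \<in> J \<Longrightarrow> y \<in> J \<Longrightarrow> x + y \<in> J"
  using diff_mem[of x "- y"] uminus_mem[of y] by simp

lemma cong_refl [simp]: "x \<approx> x"
  by (simp add: cong_mod_def zero_mem)

lemma cong_sym: "x \<approx> y \<Longrightarrow> y \<approx> x"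
  using uminus_mem[of "x - y"] by (simp add: cong_mod_def)

lemma cong_trans [trans]: "x \<approx> y \<Longrightarrow> y \<approx> z \<Longrightarrow> x \<approx> z"
  using add_mem[of "x - y" "y - z"] by (simp add: cong_mod_def)

lemma cong_add: "x \<approx> y \<Longrightarrow> u \<approx> v \<Longrightarrow> x + u \<approx> y + v"
  using add_mem[of "x - y" "u - v"] by (simp add: cong_mod_def algebra_simps)

lemma cong_diff: "x \<approx> y \<Longrightarrow> u \<approx> v \<Longrightarrow> x - u \<approx> y - v"
  using diff_mem[of "x - y" "u - v"] by (simp add: cong_mod_def algebra_simps)

lemma cong_lmult: "x \<approx> y \<Longrightarrow> z * x \<approx> z * y"
  using lmult_mem[of "x - y" z] by (simp add: cong_mod_def algebra_simps)

lemma cong_rmult: "x \<approx> y \<Longrightarrow> x * z \<approx> y * z"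
  using rmult_mem[of "x - y" z] by (simp add: cong_mod_def algebra_simps)

lemma cong_sum: "(\<And>x. x \<in> S \<Longrightarrow> f x \<approx> g x) \<Longrightarrow> sum f S \<approx> sum g S"
  by (induction S rule: infinite_finite_induct) (auto intro: cong_add)

lemma cong_0_iff: "x \<approx> 0 \<longleftrightarrow> x \<in> J"
  by (simp add: cong_mod_def)

end

text \<open>
  Here \<open>c\<close> embeds the scalars and \<open>L\<close> is the inverse of \<open>K\<close> modulo the ideal.
\<close>

locale uq_sl2_congruence = ideal_congruence J
  for J :: "'a::ring_1 set" +
  fixes q :: "'k::field" and c :: "'k \<Rightarrow> 'a" and E F K L :: 'a
  assumes q_nonzero: "q \<noteq> 0" and q_denominator: "q - inverse q \<noteq> 0"
    and c_add: "c (x + y) = c x + c y"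
    and c_mult: "c (x * y) = c x * c y"
    and c_one: "c 1 = 1"
    and c_central: "c x * z = z * c x"
    and KL: "K * L \<approx> 1" and LK: "L * K \<approx> 1"
    and KEL: "K * E * L \<approx> c (q powi 2) * E"
    and KFL: "K * F * L \<approx> c (q powi (- 2)) * F"
    and EF_commutator: "E * F - F * E \<approx> c (1 / (q - inverse q)) * (K - L)"
begin

lemma c_0: "c 0 = 0"
  using c_add[of 0 0] by simp

lemma c_minus: "c (- x) = - c x"
  using c_add[of x "- x"] by (simp add: c_0 eq_neg_iff_add_eq_0 add.commute)

lemma c_diff: "c (x - y) = c x - c y"
  using c_add[of x "- y"] by (simp add: c_minus)

lemma c_sum: "c (sum f S) = (\<Sum>x\<in>S. c (f x))"
  by (induction S rule: infinite_finite_induct) (auto simp: c_0 c_add)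

lemma c_left_commute: "z * (c x * w) = c x * (z * w)"
  by (metis c_central mult.assoc)

text \<open>
  Elements on which right multiplication by \<open>K\<close> acts by the scalar \<open>q\<^sup>n\<close>. The side matters: the
  idempotent \<open>e\<^sub>i\<close> stands on the left of \<open>E\<^sup>p F\<^sup>p\<close>, so the computation proceeds from left to
  right, and right multiplication by \<open>E\<close> lowers the weight while \<open>F\<close> raises it.
\<close>

definition rweight :: "'a \<Rightarrow> int \<Rightarrow> bool" where
  "rweight y n \<longleftrightarrow> y * K \<approx> c (q powi n) * y"

lemma rweight_L:
  assumes "rweight y n"
  shows "y * L \<approx> c (q powi (- n)) * y"
proof -
  have "c (q powi n) * (y * L) \<approx> y * (K * L)"
    using cong_rmult[OF assms[unfolded rweight_def], of L] by (metis cong_sym mult.assoc)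
  also have "y * (K * L) \<approx> y"
    using cong_lmult[OF KL, of y] by simp
  finally have *: "c (q powi (- n)) * (c (q powi n) * (y * L)) \<approx> c (q powi (- n)) * y"
    by (rule cong_lmult)
  have "c (q powi (- n)) * c (q powi n) = 1"
    using q_nonzero by (simp add: c_mult[symmetric] c_one power_int_minus)
  then show ?thesis
    using * by (simp add: mult.assoc[symmetric])
qed

lemma rweight_KL:
  assumes "rweight y n"
  shows "y * (c (1 / (q - inverse q)) * (K - L)) \<approx> c (qint q n) * y"
proof -
  have "y * (K - L) \<approx> c (q powi n) * y - c (q powi (- n)) * y"
    using cong_diff[OF assms[unfolded rweight_def] rweight_L[OF assms]]
    by (simp add: right_diff_distrib)
  also have "\<dots> = c (q powi n - q powi (- n)) * y"
    by (simp add: c_diff left_diff_distrib)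
  finally have "c (1 / (q - inverse q)) * (y * (K - L))
      \<approx> c (1 / (q - inverse q)) * (c (q powi n - q powi (- n)) * y)"
    by (rule cong_lmult)
  then show ?thesis
    unfolding c_left_commute[of y] by (simp add: mult.assoc[symmetric] c_mult[symmetric] qint_def)
qed

lemma skew_commute:
  assumes "K * Z * L \<approx> c x * Z"
  shows "K * Z \<approx> c x * (Z * K)"
proof -
  have "K * Z * (L * K) \<approx> K * Z"
    using cong_lmult[OF LK, of "K * Z"] by simp
  moreover have "K * Z * (L * K) \<approx> c x * (Z * K)"
    using cong_rmult[OF assms, of K] by (simp add: mult.assoc)
  ultimately show ?thesis
    using cong_sym cong_trans by blast
qed

lemma rweight_skew:
  assumes "rweight y n" "K * Z * L \<approx> c (q powi m) * Z"
  shows "rweight (y * Z) (n - m)"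
proof -
  have "c (q powi m) * (y * Z * K) \<approx> y * (K * Z)"
    using cong_lmult[OF skew_commute[OF assms(2)], of y]
    by (simp add: c_left_commute mult.assoc cong_sym)
  also have "\<dots> \<approx> c (q powi n) * (y * Z)"
    using cong_rmult[OF assms(1)[unfolded rweight_def], of Z] by (simp add: mult.assoc)
  finally have *: "c (q powi (- m)) * (c (q powi m) * (y * Z * K))
      \<approx> c (q powi (- m)) * (c (q powi n) * (y * Z))"
    by (rule cong_lmult)
  have "q powi (- m) * q powi m = 1" "q powi (- m) * q powi n = q powi (n - m)"
    using q_nonzero by (simp_all add: power_int_minus power_int_diff field_simps)
  then have "c (q powi (- m)) * c (q powi m) = 1"
    "c (q powi (- m)) * c (q powi n) = c (q powi (n - m))"
    by (simp_all add: c_mult[symmetric] c_one)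
  then show ?thesis
    using * unfolding rweight_def by (simp add: mult.assoc[symmetric])
qed

lemma rweight_E: "rweight y n \<Longrightarrow> rweight (y * E) (n - 2)"
  by (rule rweight_skew[OF _ KEL])

lemma rweight_F: "rweight y n \<Longrightarrow> rweight (y * F) (n + 2)"
  using rweight_skew[OF _ KFL, of y n] by simp

lemma rweight_E_power: "rweight y n \<Longrightarrow> rweight (y * E ^ p) (n - 2 * int p)"
proof (induction p)
  case (Suc p)
  then show ?case
    using rweight_E[of "y * E ^ p" "n - 2 * int p"]
    by (simp add: power_Suc2 mult.assoc algebra_simps del: power_Suc)
qed simp

lemma F_E:
  assumes "rweight y n"
  shows "y * F * E \<approx> y * E * F - c (qint q n) * y"
proof -
  have "y * F * E = y * E * F - y * (E * F - F * E)"
    by (simp add: algebra_simps)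
  also have "\<dots> \<approx> y * E * F - y * (c (1 / (q - inverse q)) * (K - L))"
    by (intro cong_diff cong_refl cong_lmult EF_commutator)
  also have "\<dots> \<approx> y * E * F - c (qint q n) * y"
    by (intro cong_diff cong_refl rweight_KL assms)
  finally show ?thesis .
qed

text \<open>
  The \<open>p + 1\<close> commutators that arise from moving \<open>E\<close> to the left are scalars, since each of them
  stands behind a weight vector; their sum collapses to one product of quantum integers.
\<close>

lemma F_power_E:
  assumes "rweight y n"
  shows "y * F ^ Suc p * E
    \<approx> y * E * F ^ Suc p - c (qint q (int p + 1) * qint q (n + int p)) * (y * F ^ p)"
  using assms
proof (induction p arbitrary: y n)
  case 0
  then show ?case
    using F_E by (simp add: qint_1[OF q_denominator])
next
  case (Suc p)
  let ?r = "qint q (int p + 1) * qint q (n + 2 + int p)"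
  have "y * F ^ Suc (Suc p) * E = (y * F) * F ^ Suc p * E"
    by (simp add: mult.assoc)
  also have "\<dots> \<approx> (y * F) * E * F ^ Suc p - c ?r * ((y * F) * F ^ p)"
    by (rule Suc.IH[OF rweight_F[OF Suc.prems]])
  also have "\<dots> \<approx> (y * E * F - c (qint q n) * y) * F ^ Suc p - c ?r * ((y * F) * F ^ p)"
    by (intro cong_diff cong_refl cong_rmult F_E Suc.prems)
  also have "\<dots> = y * E * F ^ Suc (Suc p) - c (qint q n + ?r) * (y * F ^ Suc p)"
    by (simp add: c_add algebra_simps)
  also have "qint q n + ?r = qint q (int (Suc p) + 1) * qint q (n + int (Suc p))"
    using qint_Suc_exchange[OF q_nonzero q_denominator, of n "int p + 1"]
    by (simp add: algebra_simps)
  finally show ?case .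
qed

end

text \<open>
  The only properties of \<open>e\<^sub>i\<close> that the multiplication table of the elements \<open>e\<^sub>i E\<^sup>p F\<^sup>p\<close> depends on.
\<close>

locale weight_idempotent = uq_sl2_congruence +
  fixes i :: nat and e :: 'a
  assumes e_weight: "rweight e (- int i)"
    and e_idem: "e * e \<approx> e"
    and e_EF: "e * (E * F) \<approx> E * F * e"
begin

definition diag :: "nat \<Rightarrow> 'a" where
  "diag p = e * E ^ p * F ^ p"

text \<open>
  The commutation rule for \<open>E\<close> and \<open>F\<^sup>p\<close> applied behind \<open>e E\<^sup>p\<close>, which has right weight \<open>-i - 2p\<close>.
\<close>

lemma diag_Suc: "diag p * (E * F) \<approx> diag (Suc p) + c (EF_root q i p) * diag p"
proof (cases p)
  case 0
  then show ?thesis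
    by (simp add: diag_def EF_root_def c_0 mult.assoc)
next
  case (Suc r)
  define y where "y = e * E ^ p"
  have y: "rweight y (- int i - 2 * int p)"
    unfolding y_def by (rule rweight_E_power[OF e_weight])
  have coeff: "qint q (int r + 1) * qint q (- int i - 2 * int p + int r) = - EF_root q i p"
  proof -
    have "- int i - 2 * int p + int r = - (int p + 1 + int i)"
      by (simp add: Suc)
    then show ?thesis
      by (simp only: qint_minus EF_root_def) (simp add: Suc algebra_simps)
  qed
  have "diag p * (E * F) = y * F ^ Suc r * E * F"
    by (simp add: diag_def y_def Suc mult.assoc)
  also have "\<dots> \<approx> (y * E * F ^ Suc r
      - c (qint q (int r + 1) * qint q (- int i - 2 * int p + int r)) * (y * F ^ r)) * F"
    by (rule cong_rmult[OF F_power_E[OF y]])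
  also have "\<dots> = y * E * F ^ Suc p + c (EF_root q i p) * (y * F ^ p)"
    unfolding coeff by (simp add: Suc c_minus algebra_simps power_commutes)
  also have "\<dots> = diag (Suc p) + c (EF_root q i p) * diag p"
    by (simp add: diag_def y_def mult.assoc power_commutes)
  finally show ?thesis .
qed

lemma diag_Suc': "diag (Suc p) \<approx> diag p * (E * F) - c (EF_root q i p) * diag p"
  using cong_diff[OF cong_sym[OF diag_Suc[of p]] cong_refl, of "c (EF_root q i p) * diag p"]
  by simp

text \<open>
  Modulo the ideal, \<open>diag p\<close> is \<open>e\<close> times a polynomial in \<open>EF\<close>.
\<close>

lemma EF_diag_commute: "E * F * diag p \<approx> diag p * (E * F)"
proof (induction p)
  case 0
  then show ?case
    using e_EF by (simp add: diag_def cong_sym)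
next
  case (Suc p)
  let ?s = "c (EF_root q i p)"
  have "E * F * diag (Suc p) \<approx> E * F * (diag p * (E * F) - ?s * diag p)"
    by (rule cong_lmult[OF diag_Suc'])
  also have "\<dots> = E * F * diag p * (E * F) - ?s * (E * F * diag p)"
    by (simp add: right_diff_distrib c_left_commute mult.assoc)
  also have "\<dots> \<approx> diag p * (E * F) * (E * F) - ?s * (diag p * (E * F))"
    by (intro cong_diff cong_rmult cong_lmult Suc)
  also have "\<dots> = (diag p * (E * F) - ?s * diag p) * (E * F)"
    by (simp add: left_diff_distrib mult.assoc)
  also have "\<dots> \<approx> diag (Suc p) * (E * F)"
    by (rule cong_rmult[OF cong_sym[OF diag_Suc']])
  finally show ?case .
qed

text \<open>
  Multiplying the formula for \<open>m\<close> by \<open>EF - c\<^sub>m\<close> and writing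
  \<open>EF - c\<^sub>m = (EF - c\<^bsub>m+s-j\<^esub>) + (c\<^bsub>m+s-j\<^esub> - c\<^sub>m)\<close> in the \<open>j\<close>-th term turns it into the formula for \<open>m + 1\<close>
  by the recursion of the coefficients. The sum runs to \<open>m\<close> instead of \<open>min m s\<close> to keep its range
  independent of \<open>s\<close>; the additional coefficients are zero.
\<close>

lemma diag_mult:
  assumes "qfact q m \<noteq> 0"
  shows "diag m * diag s \<approx> (\<Sum>j\<le>m. c (idem_coeff q i m s j) * diag (m + s - j))"
  using assms
proof (induction m)
  case 0
  have "diag 0 * diag s = e * e * (E ^ s * F ^ s)"
    by (simp add: diag_def mult.assoc)
  also have "\<dots> \<approx> e * (E ^ s * F ^ s)"
    by (rule cong_rmult[OF e_idem])
  finally show ?case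
    by (simp add: idem_coeff_0 c_one diag_def mult.assoc)
next
  case (Suc m)
  define A where "A r j = idem_coeff q i r s j" for r j
  let ?v = "\<lambda>p. EF_root q i p"
  have nz: "qfact q (Suc j) \<noteq> 0" if "j \<le> m" for j
    using Suc.prems that unfolding qfact_def prod_zero_iff[OF finite_atLeastAtMost] by auto
  have IH: "diag m * diag s \<approx> (\<Sum>j\<le>m. c (A m j) * diag (m + s - j))"
    using Suc.IH nz[of "m - 1"] unfolding A_def
    by (cases m) (auto simp: qfact_def)
  have "diag (Suc m) * diag s \<approx> (diag m * (E * F) - c (?v m) * diag m) * diag s"
    by (rule cong_rmult[OF diag_Suc'])
  also have "\<dots> = diag m * (E * F * diag s) - c (?v m) * (diag m * diag s)"
    by (simp add: algebra_simps)
  also have "\<dots> \<approx> diag m * (diag s * (E * F)) - c (?v m) * (diag m * diag s)"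
    by (intro cong_diff cong_lmult EF_diag_commute cong_refl)
  also have "\<dots> = diag m * diag s * (E * F) - c (?v m) * (diag m * diag s)"
    by (simp add: mult.assoc)
  also have "\<dots> \<approx> (\<Sum>j\<le>m. c (A m j) * diag (m + s - j)) * (E * F)
      - c (?v m) * (\<Sum>j\<le>m. c (A m j) * diag (m + s - j))"
    by (intro cong_diff cong_rmult cong_lmult IH)
  also have "\<dots> = (\<Sum>j\<le>m. c (A m j) * (diag (m + s - j) * (E * F))
      - c (?v m * A m j) * diag (m + s - j))"
    by (simp add: sum_distrib_left sum_distrib_right sum_subtractf c_mult mult.assoc)
  also have "\<dots> \<approx> (\<Sum>j\<le>m. c (A m j) * (diag (Suc (m + s - j)) + c (?v (m + s - j)) * diag (m + s - j))
      - c (?v m * A m j) * diag (m + s - j))"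
    by (intro cong_sum cong_diff cong_lmult diag_Suc cong_refl)
  also have "\<dots> = (\<Sum>j\<le>m. c (A m j) * diag (Suc m + s - j))
      + (\<Sum>j\<le>m. c ((?v (m + s - j) - ?v m) * A m j) * diag (Suc m + s - Suc j))"
    unfolding sum.distrib[symmetric]
  proof (intro sum.cong refl)
    fix j assume "j \<in> {..m}"
    have "c ((?v (m + s - j) - ?v m) * A m j) = c (A m j) * c (?v (m + s - j)) - c (?v m * A m j)"
      by (simp add: c_mult[symmetric] c_diff[symmetric] algebra_simps)
    then show "c (A m j) * (diag (Suc (m + s - j)) + c (?v (m + s - j)) * diag (m + s - j))
        - c (?v m * A m j) * diag (m + s - j)
      = c (A m j) * diag (Suc m + s - j)
        + c ((?v (m + s - j) - ?v m) * A m j) * diag (Suc m + s - Suc j)"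
      using \<open>j \<in> {..m}\<close> by (simp add: Suc_diff_le distrib_left left_diff_distrib mult.assoc)
  qed
  also have "(\<Sum>j\<le>m. c (A m j) * diag (Suc m + s - j))
      = diag (Suc m + s) + (\<Sum>j\<le>m. c (A m (Suc j)) * diag (Suc m + s - Suc j))"
  proof -
    have "(\<Sum>j\<le>m. c (A m j) * diag (Suc m + s - j)) = (\<Sum>j\<le>Suc m. c (A m j) * diag (Suc m + s - j))"
      by (simp add: A_def idem_coeff_eq_0 c_0)
    also have "\<dots> = diag (Suc m + s) + (\<Sum>j\<le>m. c (A m (Suc j)) * diag (Suc m + s - Suc j))"
      unfolding sum.atMost_Suc_shift by (simp add: A_def idem_coeff_0 c_one)
    finally show ?thesis .
  qed
  also have "diag (Suc m + s) + (\<Sum>j\<le>m. c (A m (Suc j)) * diag (Suc m + s - Suc j))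
      + (\<Sum>j\<le>m. c ((?v (m + s - j) - ?v m) * A m j) * diag (Suc m + s - Suc j))
      = diag (Suc m + s) + (\<Sum>j\<le>m. c (A (Suc m) (Suc j)) * diag (Suc m + s - Suc j))"
    unfolding add.assoc sum.distrib[symmetric] A_def
    by (intro arg_cong2[of _ _ _ _ "(+)"] refl sum.cong)
      (simp add: idem_coeff_Suc[OF q_nonzero nz] c_add distrib_right)
  also have "\<dots> = (\<Sum>j\<le>Suc m. c (A (Suc m) j) * diag (Suc m + s - j))"
    unfolding sum.atMost_Suc_shift by (simp add: A_def idem_coeff_0 c_one)
  finally show ?case
    by (simp only: A_def)
qed

end

section \<open>The weight idempotent and squares of combinations\<close>

context uq_sl2_congruence
begin

lemma c_of_nat: "c (of_nat n) = of_nat n"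
  by (induction n) (simp_all add: c_0 c_one c_add)

lemma c_mult_power: "(c x * z) ^ n = c (x ^ n) * z ^ n"
  by (induction n) (simp_all add: c_one c_mult c_left_commute[of z] mult.assoc)

lemma cong_commute_power: "z * w \<approx> w * z \<Longrightarrow> z ^ n * w \<approx> w * z ^ n"
proof (induction n)
  case (Suc n)
  have "z ^ Suc n * w = z * (z ^ n * w)"
    by (simp add: mult.assoc)
  also have "\<dots> \<approx> z * (w * z ^ n)"
    by (intro cong_lmult Suc)
  also have "\<dots> = (z * w) * z ^ n"
    by (simp add: mult.assoc)
  also have "\<dots> \<approx> (w * z) * z ^ n"
    by (intro cong_rmult Suc)
  finally show ?case
    by (simp add: mult.assoc)
qed simp

lemma K_EF_commute: "K * (E * F) \<approx> E * F * K"
proof -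
  have "K * (E * F) = K * E * F"
    by (simp add: mult.assoc)
  also have "\<dots> \<approx> c (q powi 2) * (E * K) * F"
    by (intro cong_rmult skew_commute KEL)
  also have "\<dots> = c (q powi 2) * (E * (K * F))"
    by (simp add: mult.assoc)
  also have "\<dots> \<approx> c (q powi 2) * (E * (c (q powi (- 2)) * (F * K)))"
    by (intro cong_lmult skew_commute KFL)
  also have "\<dots> = c (q powi 2 * q powi (- 2)) * (E * F * K)"
    by (simp add: c_mult c_left_commute[of E] mult.assoc)
  also have "q powi 2 * q powi (- 2) = 1"
    using q_nonzero by (subst power_int_add[symmetric]) auto
  finally show ?thesis
    by (simp add: c_one)
qed

text \<open>
  A lift of \<open>e\<^sub>i\<close>.
\<close>

definition weight_projector :: "nat \<Rightarrow> nat \<Rightarrow> 'a" where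
  "weight_projector l i = c (1 / of_nat l) * (\<Sum>s<l. (c (q ^ i) * K) ^ s)"

text \<open>
  Right multiplication by \<open>q\<^sup>i K\<close> permutes the powers of \<open>q\<^sup>i K\<close> cyclically, as its \<open>l\<close>-th power is \<open>1\<close>.
\<close>

lemma weight_projector_absorbs:
  assumes "q ^ l = 1" "K ^ l \<approx> 1"
  shows "weight_projector l i * (c (q ^ i) * K) \<approx> weight_projector l i"
proof -
  define G where "G = c (q ^ i) * K"
  have "q ^ (i * l) = 1"
    using assms(1) by (simp add: power_mult mult.commute[of i])
  then have "G ^ l = K ^ l"
    unfolding G_def c_mult_power by (simp add: c_one flip: power_mult)
  then have "G ^ l \<approx> 1"
    using assms(2) by simp
  have "(\<Sum>s<l. G ^ s) * G = (\<Sum>s<l. G ^ s) + (G ^ l - 1)"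
    by (induction l) (simp_all add: algebra_simps power_commutes)
  also have "\<dots> \<approx> (\<Sum>s<l. G ^ s) + (1 - 1)"
    by (intro cong_add cong_diff cong_refl \<open>G ^ l \<approx> 1\<close>)
  finally have "(\<Sum>s<l. G ^ s) * G \<approx> (\<Sum>s<l. G ^ s)"
    by simp
  then show ?thesis
    unfolding weight_projector_def G_def[symmetric] mult.assoc by (rule cong_lmult)
qed

lemma weight_idempotent_weight_projector:
  assumes "q ^ l = 1" "K ^ l \<approx> 1" "of_nat l \<noteq> (0::'k)"
  shows "weight_idempotent J q c E F K L i (weight_projector l i)"
proof
  define e G where "e = weight_projector l i" and "G = c (q ^ i) * K"
  have eG: "e * G \<approx> e"
    unfolding e_def G_def by (rule weight_projector_absorbs[OF assms(1,2)])
  have e_eq: "e = c (1 / of_nat l) * (\<Sum>s<l. G ^ s)"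
    by (simp add: e_def G_def weight_projector_def)
  have "q powi (- int i) * q ^ i = 1"
    using q_nonzero by (simp add: power_int_minus)
  then have "e * K = c (q powi (- int i)) * (c (q ^ i) * (e * K))"
    by (simp add: c_mult[symmetric] c_one flip: mult.assoc)
  also have "\<dots> = c (q powi (- int i)) * (e * G)"
    by (simp add: G_def c_left_commute[of e])
  also have "\<dots> \<approx> c (q powi (- int i)) * e"
    by (rule cong_lmult[OF eG])
  finally show "rweight (weight_projector l i) (- int i)"
    by (simp add: rweight_def e_def)
  have eGs: "e * G ^ s \<approx> e" for s
  proof (induction s)
    case (Suc s)
    have "e * G ^ Suc s = e * G * G ^ s"
      by (simp add: mult.assoc)
    also have "\<dots> \<approx> e * G ^ s"
      by (rule cong_rmult[OF eG])
    also note Suc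
    finally show ?case .
  qed simp
  have "e * e = c (1 / of_nat l) * (\<Sum>s<l. e * G ^ s)"
    by (subst (2) e_eq) (simp add: c_left_commute[of e] sum_distrib_left)
  also have "\<dots> \<approx> c (1 / of_nat l) * (\<Sum>s<l. e)"
    by (intro cong_lmult cong_sum eGs)
  also have "\<dots> = c (1 / of_nat l * of_nat l) * e"
    by (simp only: c_mult c_of_nat mult.assoc sum_constant card_lessThan)
  also have "\<dots> = e"
    using assms(3) by (simp add: c_one)
  finally show "weight_projector l i * weight_projector l i \<approx> weight_projector l i"
    by (simp add: e_def)
  have "G * (E * F) = c (q ^ i) * (K * (E * F))"
    by (simp add: G_def mult.assoc)
  also have "\<dots> \<approx> c (q ^ i) * (E * F * K)"
    by (intro cong_lmult K_EF_commute)
  also have "\<dots> = E * F * G"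
    by (simp add: G_def c_left_commute[of E] c_left_commute[of F] mult.assoc)
  finally have *: "G ^ s * (E * F) \<approx> E * F * G ^ s" for s
    by (rule cong_commute_power)
  have "e * (E * F) = c (1 / of_nat l) * (\<Sum>s<l. G ^ s * (E * F))"
    by (simp add: e_eq sum_distrib_right mult.assoc)
  also have "\<dots> \<approx> c (1 / of_nat l) * (\<Sum>s<l. E * F * G ^ s)"
    by (intro cong_lmult cong_sum *)
  also have "\<dots> = E * F * e"
    by (simp add: e_eq c_left_commute[of "E * F"] flip: sum_distrib_left)
  finally show "weight_projector l i * (E * F) \<approx> E * F * weight_projector l i"
    by (simp add: e_def)
qed

end

definition square_coeff :: "'k::field \<Rightarrow> nat \<Rightarrow> nat \<Rightarrow> (nat \<Rightarrow> 'k) \<Rightarrow> nat \<Rightarrow> 'k" where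
  "square_coeff q l i a p =
     (\<Sum>(m, s, j) \<in> {(m, s, j). m \<in> {0..l-1} \<and> s \<in> {0..l-1} \<and>
                              j \<in> {0..min m s} \<and> m + s - j = p}.
             idem_coeff q i m s j * a m * a s)"

context weight_idempotent
begin

lemma diag_mem:
  assumes "E ^ l \<in> J" "l \<le> p"
  shows "diag p \<in> J"
proof -
  have "E ^ p = E ^ l * E ^ (p - l)"
    using assms(2) by (simp flip: power_add)
  then show ?thesis
    unfolding diag_def using assms(1) by (simp add: lmult_mem rmult_mem)
qed

text \<open>
  Expand the square, drop the \<open>diag p\<close> with \<open>p \<ge> l\<close>, which contain \<open>E\<^sup>l\<close>, and collect the triples
  \<open>(m, s, j)\<close> according to \<open>m + s - j\<close>.
\<close>

lemma square_combination:
  assumes "E ^ l \<in> J" "l > 0" and nz: "\<And>m. m < l \<Longrightarrow> qfact q m \<noteq> 0"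
  shows "(\<Sum>p<l. c (a p) * diag p) * (\<Sum>p<l. c (a p) * diag p) \<approx> (\<Sum>p<l. c (square_coeff q l i a p) * diag p)"
proof -
  let ?x = "\<Sum>p<l. c (a p) * diag p"
  let ?h = "\<lambda>(m, s, j). c (idem_coeff q i m s j * a m * a s) * diag (m + s - j)"
  let ?g = "\<lambda>(m, s, j). m + s - j :: nat"
  let ?T = "SIGMA m:{..<l}. SIGMA s:{..<l}. {..min m s}"
  have fin: "finite ?T"
    by auto
  have "?x * ?x = (\<Sum>m<l. \<Sum>s<l. c (a m * a s) * (diag m * diag s))"
    by (simp add: sum_product c_mult c_left_commute[of "diag m" for m] mult.assoc)
  also have "\<dots> \<approx> (\<Sum>m<l. \<Sum>s<l. c (a m * a s) * (\<Sum>j\<le>m. c (idem_coeff q i m s j) * diag (m + s - j)))"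
    by (intro cong_sum cong_lmult diag_mult nz) auto
  also have "\<dots> = (\<Sum>m<l. \<Sum>s<l. \<Sum>j\<le>min m s. ?h (m, s, j))"
  proof (intro sum.cong refl)
    fix m s
    have "c (a m * a s) * (\<Sum>j\<le>m. c (idem_coeff q i m s j) * diag (m + s - j)) = (\<Sum>j\<le>m. ?h (m, s, j))"
      unfolding sum_distrib_left
    proof (intro sum.cong refl)
      fix j
      have comm: "idem_coeff q i m s j * a m * a s = a m * a s * idem_coeff q i m s j"
        by (simp add: mult_ac)
      show "c (a m * a s) * (c (idem_coeff q i m s j) * diag (m + s - j)) = ?h (m, s, j)"
        unfolding prod.case comm c_mult[of "a m * a s"] by (rule mult.assoc[symmetric])
    qed
    also have "\<dots> = (\<Sum>j\<le>min m s. ?h (m, s, j))"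
      by (intro sum.mono_neutral_right ballI) (auto simp: idem_coeff_eq_0 c_0 not_le)
    finally show "c (a m * a s) * (\<Sum>j\<le>m. c (idem_coeff q i m s j) * diag (m + s - j))
      = (\<Sum>j\<le>min m s. ?h (m, s, j))" .
  qed
  also have "\<dots> = sum ?h ?T"
    by (simp add: sum.Sigma)
  also have "\<dots> = (\<Sum>p<2 * l. sum ?h {t \<in> ?T. ?g t = p})"
    by (rule sum.group[symmetric, OF fin]) auto
  also have "\<dots> = (\<Sum>p<2 * l. c (square_coeff q l i a p) * diag p)"
  proof (intro sum.cong refl)
    fix p
    have S: "{(m, s, j). m \<in> {0..l-1} \<and> s \<in> {0..l-1} \<and> j \<in> {0..min m s} \<and> m + s - j = p}
      = {t \<in> ?T. ?g t = p}"
      using \<open>l > 0\<close> by auto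
    show "sum ?h {t \<in> ?T. ?g t = p} = c (square_coeff q l i a p) * diag p"
      unfolding square_coeff_def S c_sum sum_distrib_right
      by (intro sum.cong refl) auto
  qed
  also have "\<dots> \<approx> (\<Sum>p<2 * l. if p < l then c (square_coeff q l i a p) * diag p else 0)"
    by (intro cong_sum) (auto simp: cong_0_iff intro!: lmult_mem diag_mem[OF assms(1)])
  also have "\<dots> = (\<Sum>p<l. c (square_coeff q l i a p) * diag p)"
  proof -
    have "{p \<in> {..<2 * l}. p < l} = {..<l}" by auto
    then show ?thesis by (simp add: sum.inter_filter[symmetric])
  qed
  finally show ?thesis .
qed

end

section \<open>A representation separating the elements \<open>e\<^sub>i E\<^sup>p F\<^sup>p\<close>\<close>

lemma poly_mapping_sum_single:
  fixes x :: "'a \<Rightarrow>\<^sub>0 'b::comm_monoid_add"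
  shows "x = (\<Sum>w\<in>Poly_Mapping.keys x. Poly_Mapping.single w (Poly_Mapping.lookup x w))"
  by (rule poly_mapping_eqI)
    (auto simp: lookup_sum lookup_single when_def sum.delta in_keys_iff)

text \<open>
  Multiplicative statements about free algebras reduce to words by additivity.
\<close>

lemma poly_mapping_additive_induct:
  fixes x :: "'a \<Rightarrow>\<^sub>0 'b::comm_monoid_add"
  assumes "Q 0" "\<And>w d. Q (Poly_Mapping.single w d)" "\<And>y z. Q y \<Longrightarrow> Q z \<Longrightarrow> Q (y + z)"
  shows "Q x"
proof -
  have "Q (\<Sum>w\<in>S. Poly_Mapping.single w (f w))" if "finite S" for S :: "'a set" and f
    using that by (induction S rule: finite_induct) (auto intro: assms)
  then show ?thesis
    using finite_keys poly_mapping_sum_single[of x] by metis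
qed

lemma fa_const_central: "fa_const d * x = x * fa_const d"
  by (induction x rule: poly_mapping_additive_induct)
    (simp_all add: fa_const_def mult_single mult.commute distrib_left distrib_right)

lemma fa_const_add: "fa_const (x + y) = fa_const x + fa_const y"
  and fa_const_mult: "fa_const (x * y) = fa_const x * fa_const y"
  and fa_const_one: "fa_const 1 = 1"
  by (simp_all add: fa_const_def single_add mult_single)

definition linear_operator :: "(('i \<Rightarrow> 'k::comm_ring_1) \<Rightarrow> 'i \<Rightarrow> 'k) \<Rightarrow> bool" where
  "linear_operator T \<longleftrightarrow> (\<forall>u v. T (\<lambda>i. u i + v i) = (\<lambda>i. T u i + T v i))
     \<and> (\<forall>d v. T (\<lambda>i. d * v i) = (\<lambda>i. d * T v i))"

lemma linear_operator_zero: "linear_operator T \<Longrightarrow> T (\<lambda>i. 0) = (\<lambda>i. 0)"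
  unfolding linear_operator_def by (drule conjunct2, drule spec[of _ 0], drule spec[of _ "\<lambda>i. 0"]) simp

text \<open>
  The action of the free algebra determined by an operator for each generator, on functions
  \<open>'i \<Rightarrow> 'k\<close> as coordinate vectors.
\<close>

definition fa_act :: "('g \<Rightarrow> ('i \<Rightarrow> 'k) \<Rightarrow> 'i \<Rightarrow> 'k) \<Rightarrow> ('g fmon \<Rightarrow>\<^sub>0 'k::comm_ring_1)
    \<Rightarrow> ('i \<Rightarrow> 'k) \<Rightarrow> 'i \<Rightarrow> 'k" where
  "fa_act \<rho> x v i = (\<Sum>w\<in>Poly_Mapping.keys x. Poly_Mapping.lookup x w * foldr \<rho> (letters w) v i)"

lemma fa_act_eq_sum:
  assumes "finite S" "Poly_Mapping.keys x \<subseteq> S"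
  shows "fa_act \<rho> x v i = (\<Sum>w\<in>S. Poly_Mapping.lookup x w * foldr \<rho> (letters w) v i)"
  unfolding fa_act_def using assms by (intro sum.mono_neutral_left) (auto simp: in_keys_iff)

lemma fa_act_0 [simp]: "fa_act \<rho> 0 v = (\<lambda>i. 0)"
  by (simp add: fa_act_def fun_eq_iff)

lemma fa_act_single: "fa_act \<rho> (Poly_Mapping.single w d) v = (\<lambda>i. d * foldr \<rho> (letters w) v i)"
  by (rule ext, subst fa_act_eq_sum[of "{w}"]) (auto simp: lookup_single)

lemma fa_act_add: "fa_act \<rho> (x + y) v = (\<lambda>i. fa_act \<rho> x v i + fa_act \<rho> y v i)"
proof
  fix i
  let ?S = "Poly_Mapping.keys x \<union> Poly_Mapping.keys y"
  have "fa_act \<rho> (x + y) v i = (\<Sum>w\<in>?S. Poly_Mapping.lookup (x + y) w * foldr \<rho> (letters w) v i)"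
    by (intro fa_act_eq_sum) (auto dest: keys_add[THEN subsetD])
  also have "\<dots> = fa_act \<rho> x v i + fa_act \<rho> y v i"
    by (simp add: fa_act_eq_sum[of ?S] lookup_add distrib_right sum.distrib)
  finally show "fa_act \<rho> (x + y) v i = fa_act \<rho> x v i + fa_act \<rho> y v i" .
qed

lemma fa_act_uminus: "fa_act \<rho> (- x) v = (\<lambda>i. - fa_act \<rho> x v i)"
proof
  fix i
  show "fa_act \<rho> (- x) v i = - fa_act \<rho> x v i"
    using fa_act_add[of \<rho> x "- x" v] by (simp add: fun_eq_iff eq_neg_iff_add_eq_0 add.commute)
qed

lemma fa_act_diff: "fa_act \<rho> (x - y) v = (\<lambda>i. fa_act \<rho> x v i - fa_act \<rho> y v i)"
  using fa_act_add[of \<rho> x "- y" v] by (simp add: fa_act_uminus)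

lemma fa_act_sum: "fa_act \<rho> (sum f S) v = (\<lambda>i. \<Sum>s\<in>S. fa_act \<rho> (f s) v i)"
  by (induction S rule: infinite_finite_induct) (simp_all add: fa_act_add)

lemma fa_act_gen [simp]: "fa_act \<rho> (fa_gen g) v = \<rho> g v"
  by (simp add: fa_gen_def fa_act_single)

lemma fa_act_const [simp]: "fa_act \<rho> (fa_const d) v = (\<lambda>i. d * v i)"
  by (simp add: fa_const_def fa_act_single zero_fmon_def)

lemma fa_act_1 [simp]: "fa_act \<rho> 1 v = v"
  using fa_act_const[of \<rho> 1 v] by (simp add: fa_const_one)

locale free_algebra_rep =
  fixes \<rho> :: "'g \<Rightarrow> ('i \<Rightarrow> 'k::comm_ring_1) \<Rightarrow> 'i \<Rightarrow> 'k"
  assumes linear: "linear_operator (\<rho> g)"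
begin

lemma word_linear: "linear_operator (foldr \<rho> gs)"
proof (induction gs)
  case (Cons g gs)
  then show ?case
    using linear[of g] unfolding linear_operator_def by simp
qed (simp add: linear_operator_def)

lemma fa_act_mult: "fa_act \<rho> (x * y) v = fa_act \<rho> x (fa_act \<rho> y v)"
proof (induction x rule: poly_mapping_additive_induct)
  case (2 w d)
  show ?case
  proof (induction y rule: poly_mapping_additive_induct)
    case 1
    then show ?case
      using linear_operator_zero[OF word_linear] by (simp add: fa_act_single)
  next
    case (2 w' d')
    then show ?case
      using word_linear[of "letters w", unfolded linear_operator_def]
      by (simp add: mult_single fa_act_single plus_fmon_def mult.assoc)
  next
    case (3 y z)
    then show ?case
      using word_linear[of "letters w", unfolded linear_operator_def]
      by (simp add: distrib_left fa_act_add fa_act_single)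
  qed
qed (simp_all add: distrib_right fa_act_add)

lemma fa_act_power: "fa_act \<rho> (x ^ n) v = (fa_act \<rho> x ^^ n) v"
  by (induction n arbitrary: v) (simp_all add: fa_act_mult)

lemma fa_act_gen_power: "fa_act \<rho> (fa_gen g ^ n) v = (\<rho> g ^^ n) v"
  by (induction n arbitrary: v) (simp_all add: fa_act_mult)

lemma fa_act_zero_vector [simp]: "fa_act \<rho> x (\<lambda>i. 0) = (\<lambda>i. 0)"
  using fa_act_mult[of x 0 "\<lambda>i. 0"] by simp

definition annihilator :: "('g fmon \<Rightarrow>\<^sub>0 'k) set" where
  "annihilator = {x. \<forall>v. fa_act \<rho> x v = (\<lambda>i. 0)}"

lemma annihilator_congruence: "ideal_congruence annihilator"
  by unfold_locales (simp_all add: annihilator_def fa_act_diff fa_act_mult)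

end

lemma funpow_const:
  fixes T :: "'a \<Rightarrow> 'a"
  assumes "\<And>v. T v = z" "n > 0"
  shows "(T ^^ n) v = z"
  using assms by (cases n) auto

text \<open>
  The exponent of the eigenvalue of \<open>K\<^sub>1\<close> and \<open>K\<^sub>2\<close> on \<open>v\<^bsub>a,b\<^esub>\<close>. For \<open>K\<^sub>2\<close> any function works whose
  value drops by one when \<open>E\<^sub>1\<close> acts and grows by one when \<open>F\<^sub>1\<close> acts, as \<open>a\<^sub>1\<^sub>2 = -1\<close> demands.
\<close>

fun node_weight :: "int \<Rightarrow> node \<Rightarrow> nat \<times> nat \<Rightarrow> int" where
  "node_weight w N1 (a, b) = w + 2 * int a - 2 * int b"
| "node_weight w N2 (a, b) = int b - int a"

text \<open>
  In terms of basis vectors, \<open>E v\<^bsub>a,b\<^esub> = v\<^bsub>a+1,b\<^esub>\<close> and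
  \<open>F v\<^bsub>a,b\<^esub> = v\<^bsub>a,b+1\<^esub> - [a] [w - 2b + a - 1] v\<^bsub>a-1,b\<^esub>\<close>, as for \<open>v\<^bsub>a,b\<^esub> = E\<^sup>a F\<^sup>b v\<^bsub>0,0\<^esub>\<close>
  with \<open>v\<^bsub>0,0\<^esub>\<close> of weight \<open>w\<close>; but a shift is
  replaced by zero if it reaches an index divisible by \<open>l\<close>. The definitions give the effect on
  coordinates. Instead of restricting to \<open>a, b < l\<close>, the grid of all pairs is cut into blocks of
  side \<open>l\<close> that the operators preserve: the downward step in \<open>F\<close> does not leave a block because
  its coefficient \<open>[a]\<close> vanishes if \<open>l\<close> divides \<open>a\<close>. In this way the relations hold for all
  functions, without side conditions on their support.
\<close>

definition E_op :: "nat \<Rightarrow> (nat \<times> nat \<Rightarrow> 'k::field) \<Rightarrow> nat \<times> nat \<Rightarrow> 'k" where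
  "E_op l v = (\<lambda>(a, b). if l dvd a then 0 else v (a - 1, b))"

definition F_op :: "nat \<Rightarrow> 'k::field \<Rightarrow> int \<Rightarrow> (nat \<times> nat \<Rightarrow> 'k) \<Rightarrow> nat \<times> nat \<Rightarrow> 'k" where
  "F_op l q w v = (\<lambda>(a, b). (if l dvd b then 0 else v (a, b - 1))
     - qint q (int a + 1) * qint q (w - 2 * int b + int a) * v (a + 1, b))"

primrec gen_op :: "nat \<Rightarrow> 'k::field \<Rightarrow> int \<Rightarrow> gen \<Rightarrow> (nat \<times> nat \<Rightarrow> 'k) \<Rightarrow> nat \<times> nat \<Rightarrow> 'k" where
  "gen_op l q w (gE n) = (case n of N1 \<Rightarrow> E_op l | N2 \<Rightarrow> (\<lambda>v p. 0))"
| "gen_op l q w (gF n) = (case n of N1 \<Rightarrow> F_op l q w | N2 \<Rightarrow> (\<lambda>v p. 0))"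
| "gen_op l q w (gK n) = (\<lambda>v p. q powi node_weight w n p * v p)"
| "gen_op l q w (gKinv n) = (\<lambda>v p. q powi (- node_weight w n p) * v p)"

lemma gen_op_linear: "linear_operator (gen_op l q w g)"
  by (cases g) (auto simp: linear_operator_def fun_eq_iff E_op_def F_op_def algebra_simps
      split: node.split)

locale small_rep =
  fixes l :: nat and q :: "'k::field" and w :: int
  assumes q_nonzero: "q \<noteq> 0" and q_denominator: "q - inverse q \<noteq> 0"
    and q_root: "q ^ l = 1" and l_pos: "l > 0"
begin

sublocale free_algebra_rep "gen_op l q w"
  by unfold_locales (rule gen_op_linear)

lemma qint_dvd: "l dvd n \<Longrightarrow> qint q (int n) = 0"
  by (rule qint_eq_0_of_dvd[OF q_root]) simp

text \<open>
  The commutator is \<open>[a+1] [n+a] - [a] [n+a-1] = [n+2a]\<close> with \<open>n = w - 2b\<close>. On the edges of a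
  block, where a shift is replaced by zero, the corresponding quantum integer \<open>[a]\<close> or \<open>[a+1]\<close> vanishes.
\<close>

lemma E_F_op:
  "E_op l (F_op l q w v) p - F_op l q w (E_op l v) p = qint q (node_weight w N1 p) * v p"
proof -
  obtain a b where p: "p = (a, b)" by fastforce
  define n where "n = w - 2 * int b"
  have next0: "l dvd Suc a \<Longrightarrow> qint q (int a + 1) = 0"
    using qint_dvd[of "Suc a"] by (simp add: add.commute)
  have id: "qint q (int a + 1) * qint q (n + int a) - qint q (int a) * qint q (n + int a - 1)
      = qint q (n + 2 * int a)"
    using qint_mult_diff[OF q_nonzero, of "int a + 1" "n + int a" 1]
    by (simp add: qint_1[OF q_denominator] algebra_simps)
  have weight: "node_weight w N1 p = n + 2 * int a"
    by (simp add: p n_def)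
  show ?thesis
  proof (cases "l dvd a")
    case True
    then have "qint q (int a) = 0" by (rule qint_dvd)
    with True next0 show ?thesis
      unfolding weight id[symmetric]
      by (auto simp: p E_op_def F_op_def n_def)
  next
    case False
    then obtain a' where a: "a = Suc a'" by (cases a) auto
    with False next0 show ?thesis
      unfolding weight id[symmetric]
      by (auto simp: p a E_op_def F_op_def n_def algebra_simps)
  qed
qed

text \<open>
  The correction term is diagonal in the coordinates, which makes the rule valid for arbitrary
  vectors. For \<open>n = l\<close> it vanishes: \<open>F\<^sup>l\<close> commutes with \<open>E\<close>.
\<close>

lemma F_power_E_op:
  "(F_op l q w ^^ n) (E_op l v) p = E_op l ((F_op l q w ^^ n) v) p
    - qint q (int n) * qint q (node_weight w N1 p + int n - 1) * (F_op l q w ^^ (n - 1)) v p"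
proof (induction n arbitrary: p)
  case (Suc n)
  obtain a b where p: "p = (a, b)" by fastforce
  let ?F = "F_op l q w" and ?W = "node_weight w N1 p"
  let ?r = "qint q (int n) * qint q (?W + int n + 1)"
  have IH: "(?F ^^ n) (E_op l v) = (\<lambda>p. E_op l ((?F ^^ n) v) p
    - qint q (int n) * qint q (node_weight w N1 p + int n - 1) * (?F ^^ (n - 1)) v p)"
    by (rule ext) (rule Suc)
  have "(?F ^^ Suc n) (E_op l v) p = ?F (\<lambda>p. E_op l ((?F ^^ n) v) p
    - qint q (int n) * qint q (node_weight w N1 p + int n - 1) * (?F ^^ (n - 1)) v p) p"
    by (simp add: IH)
  also have "\<dots> = ?F (E_op l ((?F ^^ n) v)) p - ?r * ?F ((?F ^^ (n - 1)) v) p"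
    by (cases b) (auto simp: p F_op_def algebra_simps)
  also have "?F (E_op l ((?F ^^ n) v)) p = E_op l (?F ((?F ^^ n) v)) p - qint q ?W * (?F ^^ n) v p"
    by (simp add: E_F_op[symmetric])
  also have "?r * ?F ((?F ^^ (n - 1)) v) p = ?r * (?F ^^ n) v p"
    by (cases n) auto
  finally have "(?F ^^ Suc n) (E_op l v) p = E_op l ((?F ^^ Suc n) v) p
    - (qint q ?W + ?r) * (?F ^^ n) v p"
    by (simp add: algebra_simps)
  moreover have "qint q ?W + ?r = qint q (int (Suc n)) * qint q (?W + int (Suc n) - 1)"
    using qint_Suc_exchange[OF q_nonzero q_denominator, of ?W "int n"] by (simp add: algebra_simps)
  ultimately show ?case
    by simp
qed simp

lemma F_power_op_top_row:
  "l dvd Suc a \<Longrightarrow> (F_op l q w ^^ n) v (a, b) = (if b mod l < n then 0 else v (a, b - n))"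
proof (induction n arbitrary: b)
  case (Suc n)
  have "qint q (int a + 1) = 0"
    using qint_dvd[of "Suc a"] Suc.prems by (simp add: add.commute)
  then have step: "(F_op l q w ^^ Suc n) v (a, b)
      = (if l dvd b then 0 else (F_op l q w ^^ n) v (a, b - 1))"
    by (simp add: F_op_def)
  show ?case
  proof (cases "l dvd b")
    case False
    then obtain b' where b: "b = Suc b'" by (cases b) auto
    have "Suc b' mod l = Suc (b' mod l)"
      using False b by (auto simp: mod_Suc dvd_eq_mod_eq_0)
    then show ?thesis
      unfolding step using False Suc by (simp add: b)
  qed (use step in auto)
qed simp

text \<open>
  In the last row of a block \<open>F\<close> is a pure shift, hence \<open>F\<^sup>l = 0\<close> there. Because \<open>F\<^sup>l\<close> commutes with \<open>E\<close>,
  the value in row \<open>a\<close> is a value in row \<open>a + 1\<close> (for another vector), so the claim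
  descends from the last row to all rows; the induction is on the distance \<open>l - 1 - a mod l\<close> to it.
\<close>

lemma F_power_op_zero: "(F_op l q w ^^ l) v p = 0"
proof -
  obtain a b where p: "p = (a, b)" by fastforce
  have "(F_op l q w ^^ l) v (a, b) = 0" if "l - 1 - a mod l = n" for n a v
    using that
  proof (induction n arbitrary: a v)
    case 0
    then have "a mod l = l - 1"
      using mod_less_divisor[OF l_pos, of a] by linarith
    then have "l dvd Suc a"
      using l_pos by (simp add: dvd_eq_mod_eq_0 mod_Suc)
    then show ?case
      using F_power_op_top_row[of a l v b] l_pos by simp
  next
    case (Suc n)
    then have "Suc (a mod l) < l" by linarith
    then have m: "Suc a mod l = Suc (a mod l)"
      by (simp add: mod_Suc)
    then have nd: "\<not> l dvd Suc a" by (simp add: dvd_eq_mod_eq_0)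
    have "qint q (int l) = 0" by (rule qint_dvd) simp
    then have "(F_op l q w ^^ l) (E_op l v) (Suc a, b) = E_op l ((F_op l q w ^^ l) v) (Suc a, b)"
      using F_power_E_op[of l v "(Suc a, b)"] by simp
    also have "\<dots> = (F_op l q w ^^ l) v (a, b)"
      using nd by (simp add: E_op_def)
    finally show ?case
      using Suc.IH[of "Suc a" "E_op l v"] Suc.prems m by simp
  qed
  then show ?thesis by (simp add: p)
qed

lemma E_power_op: "(E_op l ^^ n) v (a, b) = (if a mod l < n then 0 else v (a - n, b))"
proof (induction n arbitrary: a)
  case (Suc n)
  show ?case
  proof (cases "l dvd a")
    case False
    then obtain a' where a: "a = Suc a'" by (cases a) auto
    have "Suc a' mod l = Suc (a' mod l)"
      using False a by (auto simp: mod_Suc dvd_eq_mod_eq_0)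
    then show ?thesis
      using False Suc by (simp add: a E_op_def)
  qed (simp add: E_op_def)
qed simp

lemma E_power_op_zero: "(E_op l ^^ l) v p = 0"
  using l_pos by (cases p) (simp add: E_power_op)


lemma diagonal_op_power:
  "((\<lambda>v p. d p * v p) ^^ n) v = (\<lambda>p. (d p ^ n :: 'k) * v p)"
  by (induction n) (simp_all add: mult.assoc)

lemma weight_commute_E_op:
  "q powi node_weight w n p * E_op l (\<lambda>p. q powi (- node_weight w n p) * v p) p
    = q powi cartan N1 n * E_op l v p"
proof -
  obtain a b where p: "p = (a, b)" by fastforce
  show ?thesis
  proof (cases "l dvd a")
    case False
    then obtain a' where a: "a = Suc a'" by (cases a) auto
    have "node_weight w n (a, b) - node_weight w n (a', b) = cartan N1 n"
      by (cases n) (simp_all add: a cartan_def)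
    then have "q powi node_weight w n (a, b) * q powi (- node_weight w n (a', b)) = q powi cartan N1 n"
      using q_nonzero by (simp add: power_int_add[symmetric])
    then show ?thesis
      by (simp add: p a E_op_def mult.assoc[symmetric])
  qed (simp add: p E_op_def)
qed

lemma weight_commute_F_op:
  "q powi node_weight w n p * F_op l q w (\<lambda>p. q powi (- node_weight w n p) * v p) p
    = q powi (- cartan N1 n) * F_op l q w v p"
proof -
  obtain a b where p: "p = (a, b)" by fastforce
  have "node_weight w n (a, b) - node_weight w n (Suc a, b) = - cartan N1 n"
    by (cases n) (simp_all add: cartan_def)
  then have 1: "q powi node_weight w n (a, b) * q powi (- node_weight w n (Suc a, b))
      = q powi (- cartan N1 n)"
    using q_nonzero by (simp add: power_int_add[symmetric])
  have 2: "q powi node_weight w n (a, b) * q powi (- node_weight w n (a, b - 1))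
      = q powi (- cartan N1 n)" if nd: "\<not> l dvd b"
  proof -
    obtain b' where b: "b = Suc b'" using nd by (cases b) auto
    have "node_weight w n (a, b) - node_weight w n (a, b') = - cartan N1 n"
      by (cases n) (simp_all add: b cartan_def)
    then show ?thesis
      using q_nonzero by (simp add: b power_int_add[symmetric])
  qed
  show ?thesis
    using 1 2 by (simp add: p F_op_def right_diff_distrib mult.assoc[symmetric])
qed

lemma powi_root: "(q powi n) ^ l = 1"
  by (metis power_int_mult power_int_of_nat mult.commute power_int_1_left q_root)

lemma U_rels_annihilated: "U_rels q \<subseteq> annihilator"
proof -
  have K: "q powi n * (q powi (- n) * y) = y" "q powi (- n) * (q powi n * y) = y" for n and y :: 'k
    using q_nonzero by (simp_all add: power_int_minus)
  have comm: "E_op l (F_op l q w v) p - F_op l q w (E_op l v) p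
      = 1 / (q - inverse q) * (q powi node_weight w N1 p * v p - q powi (- node_weight w N1 p) * v p)"
    for v p
    by (simp add: E_F_op qint_def left_diff_distrib)
  have F0: "F_op l q w (\<lambda>p. 0) = (\<lambda>p. 0)" and E0: "E_op l (\<lambda>p. 0) = (\<lambda>p. 0 :: 'k)"
    by (auto simp: E_op_def F_op_def fun_eq_iff)
  note act = annihilator_def fa_act_diff fa_act_add fa_act_mult power2_eq_square fun_eq_iff E0 F0
  have 1: "fK i * fK j - fK j * fK i \<in> annihilator" for i j
    by (simp add: act)
  have 2: "fK i * fKinv i - 1 \<in> annihilator" "fKinv i * fK i - 1 \<in> annihilator" for i
    by (simp_all add: act K)
  have 3: "fK i * fE j * fKinv i - fa_const (q powi cartan j i) * fE j \<in> annihilator" for i j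
    using weight_commute_E_op by (cases j) (simp_all add: act)
  have 4: "fK i * fF j * fKinv i - fa_const (q powi (- cartan j i)) * fF j \<in> annihilator" for i j
    using weight_commute_F_op by (cases j) (simp_all add: act)
  have 5: "fE N1 * fF N1 - fF N1 * fE N1
        - fa_const (1 / (q - inverse q)) * (fK N1 - fKinv N1) \<in> annihilator"
    using comm by (simp add: act)
  have 6: "fE i * fF j - fF j * fE i \<in> annihilator" if "(i, j) \<noteq> (N1, N1)" for i j
    using that by (cases i; cases j) (simp_all add: act)
  have 7: "fE i ^ 2 * fE j - fa_const (q + inverse q) * fE i * fE j * fE i + fE j * fE i ^ 2
      \<in> annihilator" if "i \<noteq> j" for i j
    using that by (cases i; cases j) (simp_all add: act)
  have 8: "fF i ^ 2 * fF j - fa_const (q + inverse q) * fF i * fF j * fF i + fF j * fF i ^ 2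
      \<in> annihilator" if "i \<noteq> j" for i j
    using that by (cases i; cases j) (simp_all add: act)
  show ?thesis
    unfolding U_rels_def using 1 2 3 4 5 6 7 8 by blast
qed

lemma nilpotency_relations_annihilated:
  "{fE N1 ^ l, fE12 q ^ l, fE N2 ^ l, fF N1 ^ l, fF12 q ^ l, fF N2 ^ l,
      fK N1 ^ l - 1, fK N2 ^ l - 1} \<subseteq> annihilator"
proof -
  have F0: "F_op l q w (\<lambda>p. 0) = (\<lambda>p. 0)" and E0: "E_op l (\<lambda>p. 0) = (\<lambda>p. 0 :: 'k)"
    by (auto simp: E_op_def F_op_def fun_eq_iff)
  have zero: "x ^ l \<in> annihilator" if "\<And>v. fa_act (gen_op l q w) x v = (\<lambda>p. 0)" for x
    using funpow_const[of "fa_act (gen_op l q w) x", OF that l_pos]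
    by (simp add: annihilator_def fa_act_power)
  have "fE N2 ^ l \<in> annihilator" "fF N2 ^ l \<in> annihilator"
    "fE12 q ^ l \<in> annihilator" "fF12 q ^ l \<in> annihilator"
    by (rule zero, simp add: fE12_def fF12_def fa_act_diff fa_act_mult E0 F0)+
  moreover have "fE N1 ^ l \<in> annihilator" "fF N1 ^ l \<in> annihilator"
    by (auto simp: annihilator_def fa_act_gen_power E_power_op_zero F_power_op_zero)
  moreover have "fK n ^ l - 1 \<in> annihilator" for n
    by (simp add: annihilator_def fa_act_gen_power fa_act_diff diagonal_op_power powi_root)
  ultimately show ?thesis
    by blast
qed

text \<open>
  The images of \<open>v\<^bsub>0,0\<^esub>\<close> under the \<open>E\<^sup>p F\<^sup>p\<close> are distinct basis vectors. The vectors
  \<open>F\<^sup>p v\<^bsub>0,0\<^esub>\<close> stay in the row \<open>a = 0\<close>, where the downward step of \<open>F\<close> is zero.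
\<close>

lemma E_power_F_power_vacuum:
  assumes "p < l"
  shows "fa_act (gen_op l q w) (fE N1 ^ p * fF N1 ^ p) (\<lambda>x. if x = (0, 0) then 1 else 0)
    = (\<lambda>x. if x = (p, p) then 1 else 0)"
proof -
  let ?vac = "\<lambda>x :: nat \<times> nat. if x = (0, 0) then 1 else 0 :: 'k"
  have F: "(F_op l q w ^^ p) ?vac = (\<lambda>x. if x = (0, p) then 1 else 0)"
    using assms
  proof (induction p)
    case (Suc p)
    then have IH: "(F_op l q w ^^ p) ?vac = (\<lambda>x. if x = (0, p) then 1 else 0)"
      by simp
    have nd: "\<not> l dvd Suc p"
      using Suc.prems by (auto dest: dvd_imp_le)
    show ?case
    proof
      fix x :: "nat \<times> nat"
      obtain a b where x: "x = (a, b)" by fastforce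
      show "(F_op l q w ^^ Suc p) ?vac x = (if x = (0, Suc p) then 1 else 0)"
        using nd by (cases b) (auto simp: IH x F_op_def)
    qed
  qed simp
  have "(E_op l ^^ p) (\<lambda>x. if x = (0, p) then 1 else 0) x = (if x = (p, p) then 1 else 0 :: 'k)" for x
  proof -
    obtain a b where x: "x = (a, b)" by fastforce
    have "a mod l \<le> a" by simp
    then show ?thesis
      using assms by (auto simp: x E_power_op)
  qed
  then show ?thesis
    by (simp add: fa_act_mult fa_act_gen_power F fun_eq_iff)
qed


text \<open>
  On \<open>v\<^bsub>p,p\<^esub>\<close>, of weight \<open>w = -i\<close>, the element \<open>q\<^sup>i K\<close> acts as the identity.
\<close>

lemma weight_projector_act:
  assumes "w = - int i" "of_nat l \<noteq> (0 :: 'k)"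
  shows "fa_act (gen_op l q w) (fa_const (1 / of_nat l) * (\<Sum>s<l. (fa_const (q ^ i) * fK N1) ^ s))
      (\<lambda>x. if x = (p, p) then 1 else 0) = (\<lambda>x. if x = (p, p) then 1 else 0)"
proof -
  let ?v = "\<lambda>x :: nat \<times> nat. if x = (p, p) then 1 else 0 :: 'k"
  have "fa_act (gen_op l q w) (fa_const (q ^ i) * fK N1) ?v = ?v"
    using q_nonzero by (simp add: fa_act_mult) (auto simp: fun_eq_iff assms(1) power_int_minus)
  then have "fa_act (gen_op l q w) ((fa_const (q ^ i) * fK N1) ^ s) ?v = ?v" for s
    by (induction s) (simp_all add: fa_act_mult)
  then show ?thesis
    using assms(2) by (simp add: fa_act_mult fa_act_sum fun_eq_iff)
qed

end

section \<open>The quotient algebras as a congruence on the free algebra\<close>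

lemma ring_of_type_algebra_ring: "ring (ring_of_type_algebra :: 'a::ring_1 ring)"
proof -
  have "\<exists>y. x + y = 0" for x :: 'a
    using add.right_inverse by blast
  then show ?thesis
    unfolding ring_of_type_algebra_def using add.right_inverse
    by unfold_locales (auto simp: algebra_simps Units_def)
qed

lemma ring_of_type_algebra_simps [simp]:
  "carrier ring_of_type_algebra = (UNIV :: 'a::ring_1 set)"
  "monoid.mult ring_of_type_algebra x y = x * y"
  "monoid.one ring_of_type_algebra = 1"
  "ring.zero ring_of_type_algebra = 0"
  "ring.add ring_of_type_algebra x y = x + y"
  by (simp_all add: ring_of_type_algebra_def)

lemma (in ideal_congruence) ideal_ring_of_type_algebra: "ideal J ring_of_type_algebra"
proof (rule idealI[OF ring_of_type_algebra_ring])
  interpret R: ring "ring_of_type_algebra :: 'a ring"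
    by (rule ring_of_type_algebra_ring)
  have minus: "\<ominus>\<^bsub>ring_of_type_algebra\<^esub> x = - x" for x :: 'a
    by (rule R.minus_equality) simp_all
  show "subgroup J (add_monoid ring_of_type_algebra)"
  proof (rule group.subgroupI[OF R.a_group])
    fix x assume "x \<in> J"
    then show "inv\<^bsub>add_monoid ring_of_type_algebra\<^esub> x \<in> J"
      using uminus_mem by (simp only: a_inv_def[symmetric] minus)
  qed (use zero_mem add_mem in auto)
qed (simp_all add: lmult_mem rmult_mem)

context
  fixes q :: "'k::field"
begin

interpretation A: ring "ring_of_type_algebra :: 'k free_alg ring"
  by (rule ring_of_type_algebra_ring)

lemma U_ideal_ideal: "ideal (U_ideal q) ring_of_type_algebra"
  unfolding U_ideal_def by (rule A.genideal_ideal) simp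

interpretation I: ideal "U_ideal q" ring_of_type_algebra
  by (rule U_ideal_ideal)

lemma U_alg_ring: "ring (U_alg q)"
  unfolding U_alg_def by (rule I.quotient_is_ring)

lemma to_U_hom: "to_U q \<in> ring_hom ring_of_type_algebra (U_alg q)"
  unfolding U_alg_def to_U_def[abs_def] by (rule I.rcos_ring_hom)

lemma to_U_surj: "carrier (U_alg q) = range (to_U q)"
  by (auto simp: U_alg_def to_U_def FactRing_def A_RCOSETS_def')

interpretation U: ring "U_alg q"
  by (rule U_alg_ring)

lemma u_ideal_ideal: "ideal (u_ideal l q) (U_alg q)"
  unfolding u_ideal_def by (rule U.genideal_ideal) (auto simp: to_U_surj)

lemma u_alg_ring: "ring (u_alg l q)"
  unfolding u_alg_def by (rule ideal.quotient_is_ring[OF u_ideal_ideal])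

lemma to_u_hom: "to_u l q \<in> ring_hom ring_of_type_algebra (u_alg l q)"
proof -
  have "(+>\<^bsub>U_alg q\<^esub>) (u_ideal l q) \<circ> to_U q \<in> ring_hom ring_of_type_algebra (u_alg l q)"
    unfolding u_alg_def
    by (rule ring_hom_trans[OF to_U_hom ideal.rcos_ring_hom[OF u_ideal_ideal]])
  then show ?thesis
    by (simp add: to_u_def[abs_def] comp_def)
qed

lemma to_u_mult: "to_u l q (x * y) = to_u l q x \<otimes>\<^bsub>u_alg l q\<^esub> to_u l q y"
  and to_u_add: "to_u l q (x + y) = to_u l q x \<oplus>\<^bsub>u_alg l q\<^esub> to_u l q y"
  and to_u_one: "to_u l q 1 = \<one>\<^bsub>u_alg l q\<^esub>"
  and to_u_closed: "to_u l q x \<in> carrier (u_alg l q)"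
  using ring_hom_mult[OF to_u_hom, of x y] ring_hom_add[OF to_u_hom, of x y]
    ring_hom_one[OF to_u_hom] ring_hom_closed[OF to_u_hom, of x]
  by simp_all

lemma to_u_zero: "to_u l q 0 = \<zero>\<^bsub>u_alg l q\<^esub>"
  using ring_hom_zero[OF to_u_hom A.ring_axioms u_alg_ring] by simp

lemma to_u_uminus: "to_u l q (- x) = \<ominus>\<^bsub>u_alg l q\<^esub> to_u l q x"
proof -
  interpret R: ring "u_alg l q" by (rule u_alg_ring)
  have "to_u l q (- x) \<oplus>\<^bsub>u_alg l q\<^esub> to_u l q x = \<zero>\<^bsub>u_alg l q\<^esub>"
    by (simp add: to_u_add[symmetric] to_u_zero)
  then show ?thesis
    by (rule R.minus_equality[symmetric, OF _ to_u_closed to_u_closed])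
qed

definition u_kernel :: "nat \<Rightarrow> 'k free_alg set" where
  "u_kernel l = {x. to_u l q x = \<zero>\<^bsub>u_alg l q\<^esub>}"

lemma to_u_eq_iff: "to_u l q x = to_u l q y \<longleftrightarrow> x - y \<in> u_kernel l"
proof -
  interpret R: ring "u_alg l q" by (rule u_alg_ring)
  have "to_u l q (x - y) = to_u l q x \<ominus>\<^bsub>u_alg l q\<^esub> to_u l q y"
    using to_u_add[of l x "- y"] by (simp add: to_u_uminus R.minus_eq)
  then show ?thesis
    by (simp add: u_kernel_def R.r_right_minus_eq to_u_closed)
qed

lemma u_kernel_congruence: "ideal_congruence (u_kernel l)"
proof -
  interpret R: ring "u_alg l q" by (rule u_alg_ring)
  have "to_u l q (x - y) = to_u l q x \<ominus>\<^bsub>u_alg l q\<^esub> to_u l q y" for x y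
    using to_u_add[of l x "- y"] by (simp add: to_u_uminus R.minus_eq)
  then show ?thesis
    by unfold_locales
      (simp_all add: u_kernel_def to_u_zero to_u_mult to_u_closed R.minus_eq)
qed

lemma U_rels_subset_u_kernel: "U_rels q \<subseteq> u_kernel l"
proof
  fix x assume "x \<in> U_rels q"
  then have "x \<in> U_ideal q"
    unfolding U_ideal_def using A.genideal_self[of "U_rels q"] by auto
  then have "to_U q x = to_U q 0"
    unfolding to_U_def by (metis I.a_rcos_const A.zero_closed I.zero_closed ring_of_type_algebra_simps(4))
  then show "x \<in> u_kernel l"
    using to_u_zero by (simp add: u_kernel_def to_u_def)
qed

lemma nilpotency_relations_subset_u_kernel:
  "{fE N1 ^ l, fE12 q ^ l, fE N2 ^ l, fF N1 ^ l, fF12 q ^ l, fF N2 ^ l,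
      fK N1 ^ l - 1, fK N2 ^ l - 1} \<subseteq> u_kernel l" (is "?S \<subseteq> _")
proof
  fix x assume "x \<in> ?S"
  then have "to_U q x \<in> u_ideal l q"
    unfolding u_ideal_def using U.genideal_self[of "to_U q ` ?S"] by (auto simp: to_U_surj)
  then have "u_ideal l q +>\<^bsub>U_alg q\<^esub> to_U q x = u_ideal l q"
    by (rule abelian_subgroup.a_rcos_const[OF ideal.axioms(1)[OF u_ideal_ideal, THEN
        abelian_subgroupI3[OF _ U.is_abelian_group]]])
  then show "x \<in> u_kernel l"
    by (simp add: u_kernel_def to_u_def u_alg_def FactRing_def)
qed

text \<open>
  The kernel is described by two successive quotients. The image of \<open>N\<close> in \<open>U\<close> is an ideal that
  contains the generators of the second ideal, and its preimage is \<open>N\<close> again because \<open>N\<close>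
  contains the first ideal.
\<close>

lemma u_kernel_subset:
  assumes N: "ideal N ring_of_type_algebra" and rels: "U_rels q \<subseteq> N"
    and nil: "{fE N1 ^ l, fE12 q ^ l, fE N2 ^ l, fF N1 ^ l, fF12 q ^ l, fF N2 ^ l,
      fK N1 ^ l - 1, fK N2 ^ l - 1} \<subseteq> N" (is "?S \<subseteq> _")
  shows "u_kernel l \<subseteq> N"
proof
  interpret N: ideal N "ring_of_type_algebra :: 'k free_alg ring" by (rule N)
  have UN: "U_ideal q \<subseteq> N"
    unfolding U_ideal_def by (rule A.genideal_minimal[OF N rels])
  have image: "x \<in> N" if "to_U q x \<in> to_U q ` N" for x
  proof -
    from that obtain n where n: "n \<in> N" "to_U q x = to_U q n" by auto
    then have "x \<ominus>\<^bsub>ring_of_type_algebra\<^esub> n \<in> U_ideal q"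
      using A.quotient_eq_iff_same_a_r_cos[OF U_ideal_ideal, of x n] by (simp add: to_U_def)
    then have "x \<ominus>\<^bsub>ring_of_type_algebra\<^esub> n \<oplus>\<^bsub>ring_of_type_algebra\<^esub> n \<in> N"
      using UN n(1) by (intro N.a_closed) auto
    moreover have "\<ominus>\<^bsub>ring_of_type_algebra\<^esub> n = - n"
      by (rule A.minus_equality) simp_all
    ultimately show ?thesis
      by (simp add: A.minus_eq)
  qed
  have "ideal (to_U q ` N) (U_alg q)"
  proof (rule idealI[OF U_alg_ring])
    interpret h: ring_hom_ring ring_of_type_algebra "U_alg q" "to_U q"
      by (rule ring_hom_ringI2[OF A.ring_axioms U_alg_ring to_U_hom])
    show "subgroup (to_U q ` N) (add_monoid (U_alg q))"
    proof (rule group.subgroupI)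
      show "group (add_monoid (U_alg q))"
        by (rule U.a_group)
      show "to_U q ` N \<noteq> {}" using N.zero_closed by blast
      show "to_U q ` N \<subseteq> carrier (add_monoid (U_alg q))"
        by (auto simp: to_U_surj)
      fix x assume "x \<in> to_U q ` N"
      then obtain n where n: "n \<in> N" "x = to_U q n" by auto
      have "\<ominus>\<^bsub>U_alg q\<^esub> x = to_U q (\<ominus>\<^bsub>ring_of_type_algebra\<^esub> n)"
        using n by simp
      then show "inv\<^bsub>add_monoid (U_alg q)\<^esub> x \<in> to_U q ` N"
        using N.a_inv_closed[OF n(1)] by (simp add: a_inv_def)
    next
      fix x y assume "x \<in> to_U q ` N" "y \<in> to_U q ` N"
      then obtain n n' where n: "n \<in> N" "x = to_U q n" "n' \<in> N" "y = to_U q n'" by auto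
      have "x \<oplus>\<^bsub>U_alg q\<^esub> y = to_U q (n \<oplus>\<^bsub>ring_of_type_algebra\<^esub> n')"
        unfolding n by (simp only: ring_hom_add[OF to_U_hom] ring_of_type_algebra_simps(1) UNIV_I)
      then show "x \<otimes>\<^bsub>add_monoid (U_alg q)\<^esub> y \<in> to_U q ` N"
        using N.a_closed[OF n(1,3)] by simp
    qed
  next
    fix a x assume "a \<in> to_U q ` N" "x \<in> carrier (U_alg q)"
    then obtain n z where n: "n \<in> N" "a = to_U q n" "x = to_U q z" by (auto simp: to_U_surj)
    have "x \<otimes>\<^bsub>U_alg q\<^esub> a = to_U q (z \<otimes>\<^bsub>ring_of_type_algebra\<^esub> n)"
      "a \<otimes>\<^bsub>U_alg q\<^esub> x = to_U q (n \<otimes>\<^bsub>ring_of_type_algebra\<^esub> z)"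
      unfolding n by (simp_all only: ring_hom_mult[OF to_U_hom] ring_of_type_algebra_simps(1) UNIV_I)
    then show "x \<otimes>\<^bsub>U_alg q\<^esub> a \<in> to_U q ` N" "a \<otimes>\<^bsub>U_alg q\<^esub> x \<in> to_U q ` N"
      using N.I_l_closed[OF n(1), of z] N.I_r_closed[OF n(1), of z] by simp_all
  qed
  then have sub: "u_ideal l q \<subseteq> to_U q ` N"
    unfolding u_ideal_def using nil by (intro U.genideal_minimal) auto
  fix x assume "x \<in> u_kernel l"
  then have "u_ideal l q +>\<^bsub>U_alg q\<^esub> to_U q x = u_ideal l q"
    by (simp add: u_kernel_def to_u_def u_alg_def FactRing_def)
  then have "to_U q x \<in> u_ideal l q"
    by (intro ideal.rcos_const_imp_mem[OF u_ideal_ideal]) (simp_all add: to_U_surj)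
  then show "x \<in> N"
    using sub image by blast
qed

end

section \<open>Transfer to \<open>\<uu>\<^sub>1\<close>\<close>

text \<open>
  Stated for a bare additive map with values in a ring given by a record, since its domain is a
  type.
\<close>

lemma (in ring) add_finsum_hom_image:
  assumes "\<And>x. x \<in> S \<Longrightarrow> h (f x) \<in> carrier R" "finite S"
    and "h 0 = \<zero>" and "\<And>x y. h (x + y) = h x \<oplus> h y"
  shows "(\<Oplus>x\<in>S. h (f x)) = h (\<Sum>x\<in>S. f x)"
  using assms(2,1)
proof (induction S rule: finite_induct)
  case (insert x S)
  then have "(\<Oplus>x\<in>insert x S. h (f x)) = h (f x) \<oplus> (\<Oplus>x\<in>S. h (f x))"
    by (intro finsum_insert) auto
  with insert show ?case
    by (simp add: assms(4))
qed (simp add: assms(3))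

lemma u1_gens_subset:
  "range (uscal l q) \<union> {uE l q N1, uF l q N1, uK l q N1} \<subseteq> carrier (u_alg l q)"
  by (auto simp: uscal_def uE_def uF_def uK_def to_u_closed)

lemma u1_ring: "ring (u1_alg l q)"
  unfolding u1_alg_def by (rule ring.generate_ring_is_ring[OF u_alg_ring u1_gens_subset])

lemma u1_simps:
  "x \<otimes>\<^bsub>u1_alg l q\<^esub> y = x \<otimes>\<^bsub>u_alg l q\<^esub> y"
  "x \<oplus>\<^bsub>u1_alg l q\<^esub> y = x \<oplus>\<^bsub>u_alg l q\<^esub> y"
  "\<one>\<^bsub>u1_alg l q\<^esub> = \<one>\<^bsub>u_alg l q\<^esub>"
  "\<zero>\<^bsub>u1_alg l q\<^esub> = \<zero>\<^bsub>u_alg l q\<^esub>"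
  by (simp_all add: u1_alg_def)

lemma to_u_power: "to_u l q x [^]\<^bsub>u1_alg l q\<^esub> (n::nat) = to_u l q (x ^ n)"
  by (induction n)
    (simp_all add: nat_pow_def u1_simps to_u_one power_commutes flip: to_u_mult)

lemma to_u_mult_u1: "to_u l q x \<otimes>\<^bsub>u1_alg l q\<^esub> to_u l q y = to_u l q (x * y)"
  by (simp add: u1_simps to_u_mult)

text \<open>
  A sum in \<open>\<uu>\<^sub>1\<close> has its expected value only if the summands lie in the carrier; membership is
  checked on representatives in the free algebra.
\<close>

definition u1_lifts :: "nat \<Rightarrow> 'k::field \<Rightarrow> 'k free_alg set" where
  "u1_lifts l q = {x. to_u l q x \<in> carrier (u1_alg l q)}"

lemma u1_lifts:
  "fE N1 \<in> u1_lifts l q" "fF N1 \<in> u1_lifts l q" "fK N1 \<in> u1_lifts l q"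
  "fa_const d \<in> u1_lifts l q"
  "x \<in> u1_lifts l q \<Longrightarrow> y \<in> u1_lifts l q \<Longrightarrow> x + y \<in> u1_lifts l q"
  "x \<in> u1_lifts l q \<Longrightarrow> y \<in> u1_lifts l q \<Longrightarrow> x * y \<in> u1_lifts l q"
  "1 \<in> u1_lifts l q"
  by (auto simp: u1_lifts_def u1_alg_def to_u_add to_u_mult to_u_one uE_def uF_def uK_def uscal_def
      intro: generate_ring.intros)

lemma u1_lifts_power: "x \<in> u1_lifts l q \<Longrightarrow> x ^ n \<in> u1_lifts l q"
  by (induction n) (auto intro: u1_lifts)

lemma u1_lifts_sum: "(\<And>s. s \<in> S \<Longrightarrow> f s \<in> u1_lifts l q) \<Longrightarrow> sum f S \<in> u1_lifts l q"
  using u1_lifts(4)[of 0]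
  by (induction S rule: infinite_finite_induct) (auto intro: u1_lifts simp: fa_const_def)

lemma to_u_finsum:
  assumes "finite S" "\<And>s. s \<in> S \<Longrightarrow> f s \<in> u1_lifts l q"
  shows "(\<Oplus>\<^bsub>u1_alg l q\<^esub>s\<in>S. to_u l q (f s)) = to_u l q (sum f S)"
  using assms
  by (intro ring.add_finsum_hom_image[OF u1_ring])
    (auto simp: u1_lifts_def u1_simps to_u_zero to_u_add)

lemma u_kernel_uq_sl2:
  assumes "q \<noteq> 0" "q - inverse q \<noteq> 0"
  shows "uq_sl2_congruence (u_kernel q l) q fa_const (fE N1) (fF N1) (fK N1) (fKinv N1)"
proof -
  interpret ideal_congruence "u_kernel q l" by (rule u_kernel_congruence)
  have rel: "x \<in> U_rels q \<Longrightarrow> x \<in> u_kernel q l" for x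
    using U_rels_subset_u_kernel by blast
  have E: "fK N1 * fE N1 * fKinv N1 - fa_const (q powi cartan N1 N1) * fE N1 \<in> U_rels q"
    and F: "fK N1 * fF N1 * fKinv N1 - fa_const (q powi (- cartan N1 N1)) * fF N1 \<in> U_rels q"
    and K: "fK N1 * fKinv N1 - 1 \<in> U_rels q" "fKinv N1 * fK N1 - 1 \<in> U_rels q"
    and EF: "fE N1 * fF N1 - fF N1 * fE N1
        - fa_const (1 / (q - inverse q)) * (fK N1 - fKinv N1) \<in> U_rels q"
    unfolding U_rels_def by blast+
  have C: "cartan N1 N1 = 2" by (simp add: cartan_def)
  show ?thesis
    using rel[OF E] rel[OF F] rel[OF K(1)] rel[OF K(2)] rel[OF EF]
    by unfold_locales (rule assms fa_const_add fa_const_mult fa_const_one fa_const_central |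
        simp add: cong_mod_def C)+
qed

theorem theorem3p16:
  fixes q :: "'k::{alg_closed_field, field_char_0}"
    and l i :: nat
    and a :: "nat \<Rightarrow> 'k"
  assumes "l \<ge> 3" and "odd l"
    and "primitive_root_of_unity l q"
    and "i \<in> {0..l-1}"
  shows "idempotent_element (u1_alg l q)
      (\<Oplus>\<^bsub>u1_alg l q\<^esub>p\<in>{0..l-1}.
         uscal l q (a p) \<otimes>\<^bsub>u1_alg l q\<^esub>
           (ue l q i \<otimes>\<^bsub>u1_alg l q\<^esub> (uE l q N1 [^]\<^bsub>u1_alg l q\<^esub> p)
              \<otimes>\<^bsub>u1_alg l q\<^esub> (uF l q N1 [^]\<^bsub>u1_alg l q\<^esub> p)))
    \<longleftrightarrow> (\<forall>p\<in>{0..l-1}. a p =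
          (\<Sum>(m, s, j) \<in> {(m, s, j). m \<in> {0..l-1} \<and> s \<in> {0..l-1} \<and>
                              j \<in> {0..min m s} \<and> m + s - j = p}.
             idem_coeff q i m s j * a m * a s))"
proof -
  have l: "l > 0" and range: "{0..l-1} = {..<l}"
    using assms(1) by auto
  have root: "q ^ l = 1"
    using assms(3) by (simp add: primitive_root_of_unity_def)
  have q0: "q \<noteq> 0" by (rule primitive_root_nonzero[OF assms(3) l])
  have qd: "q - inverse q \<noteq> 0" by (rule primitive_root_qint_denominator[OF assms(3,1)])
  interpret uq_sl2_congruence "u_kernel q l" q fa_const "fE N1" "fF N1" "fK N1" "fKinv N1"
    by (rule u_kernel_uq_sl2[OF q0 qd])
  have El: "fE N1 ^ l \<in> u_kernel q l" and Kl: "cong_mod (fK N1 ^ l) 1"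
    using nilpotency_relations_subset_u_kernel[where q = q and l = l] by (auto simp: cong_mod_def)
  interpret weight_idempotent "u_kernel q l" q fa_const "fE N1" "fF N1" "fK N1" "fKinv N1" i
    "weight_projector l i"
    using l by (intro weight_idempotent_weight_projector root Kl) simp
  define x where "x = (\<Sum>p<l. fa_const (a p) * diag p)"

  have ue: "ue l q i = to_u l q (weight_projector l i)"
    unfolding ue_def uscal_def uK_def to_u_mult_u1 to_u_power weight_projector_def range
    by (subst to_u_finsum) (auto intro: u1_lifts u1_lifts_power simp: to_u_mult_u1)
  have e_lift: "weight_projector l i \<in> u1_lifts l q"
    unfolding weight_projector_def by (intro u1_lifts u1_lifts_sum u1_lifts_power)
  have term_lift: "fa_const (a p) * diag p \<in> u1_lifts l q" for p
    unfolding diag_def by (intro u1_lifts u1_lifts_power e_lift)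
  have elem: "(\<Oplus>\<^bsub>u1_alg l q\<^esub>p\<in>{0..l-1}.
         uscal l q (a p) \<otimes>\<^bsub>u1_alg l q\<^esub>
           (ue l q i \<otimes>\<^bsub>u1_alg l q\<^esub> (uE l q N1 [^]\<^bsub>u1_alg l q\<^esub> p)
              \<otimes>\<^bsub>u1_alg l q\<^esub> (uF l q N1 [^]\<^bsub>u1_alg l q\<^esub> p))) = to_u l q x"
    unfolding ue uscal_def uE_def uF_def to_u_power to_u_mult_u1 x_def diag_def[symmetric] range
    by (rule to_u_finsum) (auto intro: term_lift)

  have x_lift: "x \<in> u1_lifts l q"
    unfolding x_def by (intro u1_lifts_sum term_lift)
  have "idempotent_element (u1_alg l q) (to_u l q x) \<longleftrightarrow> x * x - x \<in> u_kernel q l"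
    using x_lift unfolding idempotent_element_def to_u_mult_u1 to_u_eq_iff[symmetric]
    by (simp add: u1_lifts_def)
  also have "\<dots> \<longleftrightarrow> cong_mod (x * x - x) 0"
    by (simp add: cong_mod_def)
  also have "\<dots> \<longleftrightarrow> cong_mod (\<Sum>p<l. fa_const (square_coeff q l i a p - a p) * diag p) 0"
  proof -
    have "cong_mod (x * x) (\<Sum>p<l. fa_const (square_coeff q l i a p) * diag p)"
      unfolding x_def
      by (intro square_combination El l qfact_nonzero[OF assms(3,1,2)])
    then have "cong_mod (x * x - x) ((\<Sum>p<l. fa_const (square_coeff q l i a p) * diag p) - x)"
      by (rule cong_diff) simp
    also have "(\<Sum>p<l. fa_const (square_coeff q l i a p) * diag p) - x
        = (\<Sum>p<l. fa_const (square_coeff q l i a p - a p) * diag p)"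
      by (simp add: x_def sum_subtractf c_diff left_diff_distrib)
    finally show ?thesis
      using cong_trans cong_sym by blast
  qed
  also have "\<dots> \<longleftrightarrow> (\<forall>p<l. square_coeff q l i a p - a p = 0)"
  proof
    assume "\<forall>p<l. square_coeff q l i a p - a p = 0"
    then have "(\<Sum>p<l. fa_const (square_coeff q l i a p - a p) * diag p) = 0"
      by (intro sum.neutral) (simp add: c_0)
    then show "cong_mod (\<Sum>p<l. fa_const (square_coeff q l i a p - a p) * diag p) 0"
      by simp
  next
    \<comment> \<open>Apply the relation to the vector \<open>v\<^bsub>0,0\<^esub>\<close> of weight \<open>-i\<close> and read off the coordinate at \<open>(p, p)\<close>.\<close>
    interpret rep: small_rep l q "- int i"
      by unfold_locales (rule q0 qd root l)+
    define d where "d p = square_coeff q l i a p - a p" for p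
    assume "cong_mod (\<Sum>p<l. fa_const (square_coeff q l i a p - a p) * diag p) 0"
    then have "(\<Sum>p<l. fa_const (d p) * diag p) \<in> rep.annihilator"
      using u_kernel_subset[OF ideal_congruence.ideal_ring_of_type_algebra[OF rep.annihilator_congruence] rep.U_rels_annihilated
          rep.nilpotency_relations_annihilated]
      by (auto simp: cong_0_iff d_def)
    then have 0: "fa_act (gen_op l q (- int i)) (\<Sum>p<l. fa_const (d p) * diag p)
        (\<lambda>x. if x = (0, 0) then 1 else 0) y = 0" for y
      by (simp add: rep.annihilator_def)
    have vac: "fa_act (gen_op l q (- int i)) (diag p) (\<lambda>x. if x = (0, 0) then 1 else 0)
        = (\<lambda>x. if x = (p, p) then 1 else 0)" if "p < l" for p
    proof -
      have "fa_act (gen_op l q (- int i)) (weight_projector l i) (\<lambda>x. if x = (p, p) then 1 else 0)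
          = (\<lambda>x. if x = (p, p) then 1 else 0)"
        unfolding weight_projector_def using l by (intro rep.weight_projector_act) simp_all
      then show ?thesis
        using rep.E_power_F_power_vacuum[OF that]
        by (simp add: diag_def mult.assoc rep.fa_act_mult)
    qed
    have "d p = 0" if "p < l" for p
    proof -
      have "(\<Sum>r<l. d r * (if (p, p) = (r, r) then 1 else 0)) = 0"
        using 0[of "(p, p)"] by (simp add: fa_act_sum rep.fa_act_mult vac)
      then show ?thesis
        using that by (simp add: if_distrib sum.delta cong: if_cong)
    qed
    then show "\<forall>p<l. square_coeff q l i a p - a p = 0"
      by (simp add: d_def)
  qed
  also have "\<dots> \<longleftrightarrow> (\<forall>p\<in>{0..l-1}. a p = square_coeff q l i a p)"
    unfolding range by auto
  finally show ?thesis
    unfolding elem square_coeff_def .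
qed

end
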